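(* Let $A\in\mathbb{R}^{m\times n}$ have rows $a_i^T$ with $\|a_i\|=1$, and assume the linear feasibility problem $C=\{x\in\mathbb{R}^n\mid A_{\mathcal I}x=b_{\mathcal I},\ A_{\mathcal J}x\le b_{\mathcal J}\}$ is consistent ($C\ne\emptyset$). Choose the block size $$\tau^*=\left\lfloor\frac{m}{\sigma_{\max}^2(A)}\right\rfloor,$$ assume that $l=m/\tau^*$ is a positive integer, and let $\{J_1,\dots,J_l\}$ be a randomized partition of the row indices $[m]$ into blocks of size $\tau^*$ (so $l\ge\sigma_{\max}^2(A)$). Assume the Bregman distance growth condition holds with constant $\gamma>0$. Then, with probability at least $1-m^{-1}$ (over the random partition), the following hold, the expectations being over the block sampling during the iterations. (a) Let $\{(x_k,x_k^* )\}$ be generated by the randomized sparse Kaczmarz scheme with inequalities (see context) with the DecmSPS stepsize $$t_k=\min\left\{\frac{1}{c}\cdot\frac{\sum_{i\in J_k}w_{i,k}f_i(x_k)}{\|\sum_{i\in J_k}w_{i,k}\nabla f_i(x_k)\|^2},\ t_{k-1}\right\},\quad k\ge0,\qquad t_{-1}=\gamma_b>0.$$ Then for $c>\frac12$ and all $k\ge 0$, $$\mathbb{E}\left[\mathrm{dist}_\psi^{x_k^*}(x_k,\bar X)^2\right]\le\left(1-\frac1c\left(1-\frac1{2c}\right)\gamma\tilde L\right)^k\mathrm{dist}_\psi^{x_0^*}(x_0,\bar X)^2,\qquad\tilde L=\min\left\{\frac{\tau^*}{12\log(1+m)},c\gamma_b\right\}.$$ (b) Let $\{(x_k,x_k^*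 )\}$ be generated by the same scheme with either the exact projective stepsize or the block adaptive extrapolated stepsize (see context). Then for all $k\ge 0$, $$\mathbb{E}\left[\mathrm{dist}_\psi^{x_k^*}(x_k,\bar X)^2\right]\le\left(1-\frac{m\gamma}{6\sigma_{\max}^2(A)\log(1+m)}\right)^k\mathrm{dist}_\psi^{x_0^*}(x_0,\bar X)^2.$$
   Context: Notation: $[m]=\{1,\dots,m\}=\mathcal I\cup\mathcal J$ (disjoint index sets of equalities and inequalities); $A=[A_{\mathcal I};A_{\mathcal J}]\in\mathbb{R}^{m\times n}$, $b=[b_{\mathcal I};b_{\mathcal J}]\in\mathbb{R}^m$; $\sigma_{\max}(A)$ is the largest singular value; $\|\cdot\|$ is the Euclidean norm; $\log$ is the natural logarithm. Functions: $e:\mathbb{R}^m\to\mathbb{R}^m$ is $e(x)_i=x_i$ for $i\in\mathcal I$ and $e(x)_i=\max\{x_i,0\}$ for $i\in\mathcal J$. $f_i(x)=\frac12\frac{|e(Ax-b)_i|^2}{\|a_i\|^2}$ (convex, with $1$-Lipschitz gradient, so $L_{\max}=1$), $F(x)=\frac1m\sum_{i=1}^mf_i(x)$, $\bar F=\min F$, $\bar X=\arg\min_{x\in\mathbb{R}^n}F(x)$ (equal to $C$ here). $\psi(x)=\lambda\|x\|_1+\frac12\|x\|_2^2$ with $\lambda>0$ (strong convexity constant $\mu=1$); $\psi^*$ is its Fenchel conjugate and $\nabla\psi^*(x)=S_\lambda(x)=\max\{|x|-\lambda,0\}\cdot\mathrm{sign}(x)$ (componentwise). For $x^*\in\partial\psi(x)$,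 $D_\psi^{x^*}(x,y)=\psi(y)-\psi(x)-\langle x^*,y-x\rangle$ and $\mathrm{dist}_\psi^{x^*}(x,\bar X)^2=\inf_{z\in\bar X}D_\psi^{x^*}(x,z)$. Bregman distance growth condition with constant $\gamma>0$: for every $x\in\mathbb{R}^n$ and $x^*\in\partial\psi(x)$, $F(x)-\bar F\ge\gamma\inf_{z\in\bar X}D_\psi^{x^*}(x,z)$. Randomized partition: for a (uniformly) random permutation $\kappa$ of $[m]$ and block size $\tau$ with $l=m/\tau$ an integer, $J_i=\{\kappa(r):r=(i-1)\tau+1,\dots,i\tau\}$, $i=1,\dots,l$. A known fact about such partitions (cited): if $A$ is row-normalized and $l\ge\sigma_{\max}^2(A)$, then with probability at least $1-m^{-1}$, $\max_{J\in\{J_1,\dots,J_l\}}\sigma_{\max}^2(A_J)\le6\log(1+m)$, where $A_J$ is the submatrix of rows indexed by $J$. Scheme: $x_0\in\mathbb{R}^n$, $x_0^*\in\partial\psi(x_0)$; at each iteration $k\ge0$ an index $i_k\in[l]$ is sampled uniformly, independently of the past, the block used is $J_k:=J_{i_k}$, weights are $w_{i,k}=1/\tau^*$, and $$x_{k+1}^*=x_k^*-t_k\sum_{i\in J_k}w_{i,k}\frac{e(Ax_k-b)_i}{\|a_i\|^2}a_i,\qquad x_{k+1}=S_\lambda(x_{k+1}^* ).$$ Projective stepsizes: with $\alpha_k=\sum_{i\in J_k}w_{i,k}\nabla f_i(x_k)$ and $\beta_k=\langle\alpha_k,x_k\rangle-\sum_{i\in J_k}w_{i,k}\|\nabla f_i(x_k)\|^2$,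 the exact projective stepsize is a solution of $\min_{t\in\mathbb{R}}\psi^*(x_k^*-t\alpha_k)+t\beta_k$; the block adaptive extrapolated stepsize is $t_k=\frac{\sum_{i\in J_k}w_{i,k}\|\nabla f_i(x_k)\|^2}{\|\sum_{i\in J_k}w_{i,k}\nabla f_i(x_k)\|^2}$. If $\nabla f_i(x_k)=0$ for all $i\in J_k$, the iterate does not move; in the DecmSPS rule the first entry of the minimum is then read as $+\infty$. *)

theory Defs
  imports "HOL-Probability.Probability"
begin

definition subdifferential :: "('a::real_inner \<Rightarrow> real) \<Rightarrow> 'a \<Rightarrow> 'a set" where
  "subdifferential f x = {s. \<forall>y. f y \<ge> f x + s \<bullet> (y - x)}"

text \<open>The supremum is taken in the reals, so this is the Fenchel conjugate wherever that conjugate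
  is finite. For the strongly convex function \<open>sparse_psi\<close> below it is finite everywhere.\<close>

definition fenchel_conjugate :: "('a::real_inner \<Rightarrow> real) \<Rightarrow> 'a \<Rightarrow> real" where
  "fenchel_conjugate f y = (SUP x. y \<bullet> x - f x)"

definition bregman :: "('a::real_inner \<Rightarrow> real) \<Rightarrow> 'a \<Rightarrow> 'a \<Rightarrow> 'a \<Rightarrow> real" where
  "bregman f xs x y = f y - f x - xs \<bullet> (y - x)"

text \<open>The square of the Bregman distance of \<open>x\<close> to the set \<open>X\<close>, with respect to the
  subgradient \<open>xs\<close>. It is used for \<open>xs \<in> subdifferential f x\<close>, where the values of
  \<open>bregman\<close> are bounded below by \<open>0\<close>, and for nonempty \<open>X\<close>.\<close>

definition bregman_dist_sq :: "('a::real_inner \<Rightarrow> real) \<Rightarrow> 'a \<Rightarrow> 'a \<Rightarrow> 'a set \<Rightarrow> real" where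
  "bregman_dist_sq f xs x X = (INF z\<in>X. bregman f xs x z)"

definition gradient :: "('a::real_inner \<Rightarrow> real) \<Rightarrow> 'a \<Rightarrow> 'a" where
  "gradient f x = (THE g. GDERIV f x :> g)"

definition argmin_set :: "('a \<Rightarrow> real) \<Rightarrow> 'a set" where
  "argmin_set f = {x. is_arg_min f (\<lambda>_. True) x}"

definition sparse_psi :: "real \<Rightarrow> real^'n \<Rightarrow> real" where
  "sparse_psi lam x = lam * (\<Sum>j\<in>UNIV. \<bar>x $ j\<bar>) + (norm x)\<^sup>2 / 2"

definition soft_threshold :: "real \<Rightarrow> real^'n \<Rightarrow> real^'n" where
  "soft_threshold lam x = (\<chi> j. max (\<bar>x $ j\<bar> - lam) 0 * sgn (x $ j))"

text \<open>The nonnegative square roots of the eigenvalues of \<open>A\<^sup>T A\<close>.\<close>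

definition singular_values :: "real^'n^'m \<Rightarrow> real set" where
  "singular_values A = {s. 0 \<le> s \<and> (\<exists>v. v \<noteq> 0 \<and> (transpose A ** A) *v v = s\<^sup>2 *\<^sub>R v)}"

definition sigma_max :: "real^'n^'m \<Rightarrow> real" where
  "sigma_max A = Max (singular_values A)"

text \<open>The rows are indexed by \<open>'m\<close>. The set \<open>I\<close> consists of the equality rows, its
  complement \<open>- I\<close> of the inequality rows.\<close>

definition feasible_set :: "real^'n^'m \<Rightarrow> real^'m \<Rightarrow> 'm set \<Rightarrow> (real^'n) set" where
  "feasible_set A b I =
     {x. (\<forall>i\<in>I. (A *v x) $ i = b $ i) \<and> (\<forall>i\<in>- I. (A *v x) $ i \<le> b $ i)}"

definition residual :: "'m set \<Rightarrow> real^'m \<Rightarrow> real^'m" where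
  "residual I y = (\<chi> i. if i \<in> I then y $ i else max (y $ i) 0)"

definition row_loss :: "real^'n^'m \<Rightarrow> real^'m \<Rightarrow> 'm set \<Rightarrow> 'm \<Rightarrow> real^'n \<Rightarrow> real" where
  "row_loss A b I i x = 1 / 2 * (\<bar>residual I (A *v x - b) $ i\<bar>\<^sup>2 / (norm (row i A))\<^sup>2)"

definition avg_loss :: "real^'n^'m \<Rightarrow> real^'m \<Rightarrow> 'm set \<Rightarrow> real^'n \<Rightarrow> real" where
  "avg_loss A b I x = 1 / real CARD('m) * (\<Sum>i\<in>UNIV. row_loss A b I i x)"

definition bregman_growth ::
    "real \<Rightarrow> real^'n^'m \<Rightarrow> real^'m \<Rightarrow> 'm set \<Rightarrow> real \<Rightarrow> bool" where
  "bregman_growth lam A b I gam \<longleftrightarrow>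
     (\<forall>x. \<forall>xs\<in>subdifferential (sparse_psi lam) x.
        avg_loss A b I x - (INF y. avg_loss A b I y)
          \<ge> gam * bregman_dist_sq (sparse_psi lam) xs x (argmin_set (avg_loss A b I)))"

text \<open>The row index type carries no order, so a permutation of the row indices is represented by
  the bijection from \<open>{1..m}\<close> onto the row index type that lists the rows in permuted order.\<close>

definition row_orderings :: "(nat \<Rightarrow> 'm::finite) set" where
  "row_orderings = {\<kappa> \<in> {1..CARD('m)} \<rightarrow>\<^sub>E UNIV. bij_betw \<kappa> {1..CARD('m)} UNIV}"

definition block :: "(nat \<Rightarrow> 'm) \<Rightarrow> nat \<Rightarrow> nat \<Rightarrow> 'm set" where
  "block \<kappa> \<tau> i = \<kappa> ` {(i - 1) * \<tau> + 1..i * \<tau>}"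

text \<open>A list \<open>h = [i\<^sub>0, \<dots>, i\<^sub>k\<^sub>-\<^sub>1]\<close> is the history of the first \<open>k\<close> sampled block indices. All random
  quantities are functions of the history: \<open>x h\<close> and \<open>xs h\<close> are the primal and the dual iterate
  with index \<open>length h\<close>, and \<open>t (h @ [i])\<close> is the stepsize with index \<open>length h\<close>, used when block
  \<open>i\<close> is sampled after the history \<open>h\<close>. In particular a stepsize may depend on the current and
  on past samples, but not on later ones, and \<open>t []\<close> is the stepsize with index \<open>-1\<close>.
  A history of \<open>k\<close> independent uniform samples has the law
  \<open>replicate_pmf k (pmf_of_set {1..l})\<close>.\<close>

definition kaczmarz_scheme ::
    "real \<Rightarrow> real^'n^'m \<Rightarrow> real^'m \<Rightarrow> 'm set \<Rightarrow> nat \<Rightarrow> nat \<Rightarrow> (nat \<Rightarrow> 'm) \<Rightarrow> real^'n \<Rightarrow> real^'n \<Rightarrow>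
     (nat list \<Rightarrow> real) \<Rightarrow> (nat list \<Rightarrow> real^'n) \<Rightarrow> (nat list \<Rightarrow> real^'n) \<Rightarrow> bool" where
  "kaczmarz_scheme lam A b I \<tau> l \<kappa> x0 xs0 t x xs \<longleftrightarrow>
     x [] = x0 \<and> xs [] = xs0 \<and>
     (\<forall>h\<in>lists {1..l}. \<forall>i\<in>{1..l}.
        xs (h @ [i]) = xs h - t (h @ [i]) *\<^sub>R
          (\<Sum>j\<in>block \<kappa> \<tau> i. (1 / real \<tau>) *\<^sub>R
             ((residual I (A *v x h - b) $ j / (norm (row j A))\<^sup>2) *\<^sub>R row j A)) \<and>
        x (h @ [i]) = soft_threshold lam (xs (h @ [i])))"

definition block_loss ::
    "real^'n^'m \<Rightarrow> real^'m \<Rightarrow> 'm set \<Rightarrow> nat \<Rightarrow> 'm set \<Rightarrow> real^'n \<Rightarrow> real" where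
  "block_loss A b I \<tau> J y = (\<Sum>j\<in>J. 1 / real \<tau> * row_loss A b I j y)"

definition block_grad ::
    "real^'n^'m \<Rightarrow> real^'m \<Rightarrow> 'm set \<Rightarrow> nat \<Rightarrow> 'm set \<Rightarrow> real^'n \<Rightarrow> real^'n" where
  "block_grad A b I \<tau> J y = (\<Sum>j\<in>J. (1 / real \<tau>) *\<^sub>R gradient (row_loss A b I j) y)"

definition block_grad_sq ::
    "real^'n^'m \<Rightarrow> real^'m \<Rightarrow> 'm set \<Rightarrow> nat \<Rightarrow> 'm set \<Rightarrow> real^'n \<Rightarrow> real" where
  "block_grad_sq A b I \<tau> J y =
     (\<Sum>j\<in>J. 1 / real \<tau> * (norm (gradient (row_loss A b I j) y))\<^sup>2)"

definition decmsps_stepsize ::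
    "real^'n^'m \<Rightarrow> real^'m \<Rightarrow> 'm set \<Rightarrow> nat \<Rightarrow> nat \<Rightarrow> (nat \<Rightarrow> 'm) \<Rightarrow> real \<Rightarrow> real \<Rightarrow>
     (nat list \<Rightarrow> real) \<Rightarrow> (nat list \<Rightarrow> real^'n) \<Rightarrow> bool" where
  "decmsps_stepsize A b I \<tau> l \<kappa> c gam_b t x \<longleftrightarrow>
     t [] = gam_b \<and>
     (\<forall>h\<in>lists {1..l}. \<forall>i\<in>{1..l}. let J = block \<kappa> \<tau> i in
        t (h @ [i]) =
          (if \<forall>j\<in>J. gradient (row_loss A b I j) (x h) = 0 then t h
           else min (1 / c * (block_loss A b I \<tau> J (x h) / (norm (block_grad A b I \<tau> J (x h)))\<^sup>2))
                    (t h)))"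

definition exact_projective_stepsize ::
    "real \<Rightarrow> real^'n^'m \<Rightarrow> real^'m \<Rightarrow> 'm set \<Rightarrow> nat \<Rightarrow> nat \<Rightarrow> (nat \<Rightarrow> 'm) \<Rightarrow>
     (nat list \<Rightarrow> real) \<Rightarrow> (nat list \<Rightarrow> real^'n) \<Rightarrow> (nat list \<Rightarrow> real^'n) \<Rightarrow> bool" where
  "exact_projective_stepsize lam A b I \<tau> l \<kappa> t x xs \<longleftrightarrow>
     (\<forall>h\<in>lists {1..l}. \<forall>i\<in>{1..l}.
        let J = block \<kappa> \<tau> i;
            \<alpha> = block_grad A b I \<tau> J (x h);
            \<beta> = \<alpha> \<bullet> x h - block_grad_sq A b I \<tau> J (x h)
        in is_arg_min (\<lambda>s. fenchel_conjugate (sparse_psi lam) (xs h - s *\<^sub>R \<alpha>) + s * \<beta>)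
             (\<lambda>_. True) (t (h @ [i])))"

text \<open>If all gradients of the sampled block vanish, the quotient is undefined; the stepsize is
  then left unconstrained, and the iterate does not move whatever its value.\<close>

definition adaptive_extrapolated_stepsize ::
    "real^'n^'m \<Rightarrow> real^'m \<Rightarrow> 'm set \<Rightarrow> nat \<Rightarrow> nat \<Rightarrow> (nat \<Rightarrow> 'm) \<Rightarrow>
     (nat list \<Rightarrow> real) \<Rightarrow> (nat list \<Rightarrow> real^'n) \<Rightarrow> bool" where
  "adaptive_extrapolated_stepsize A b I \<tau> l \<kappa> t x \<longleftrightarrow>
     (\<forall>h\<in>lists {1..l}. \<forall>i\<in>{1..l}. let J = block \<kappa> \<tau> i in
        (\<exists>j\<in>J. gradient (row_loss A b I j) (x h) \<noteq> 0) \<longrightarrow>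
        t (h @ [i]) = block_grad_sq A b I \<tau> J (x h) / (norm (block_grad A b I \<tau> J (x h)))\<^sup>2)"

definition expected_dist_sq ::
    "real \<Rightarrow> real^'n^'m \<Rightarrow> real^'m \<Rightarrow> 'm set \<Rightarrow> nat \<Rightarrow>
     (nat list \<Rightarrow> real^'n) \<Rightarrow> (nat list \<Rightarrow> real^'n) \<Rightarrow> nat \<Rightarrow> real" where
  "expected_dist_sq lam A b I l x xs k =
     measure_pmf.expectation (replicate_pmf k (pmf_of_set {1..l}))
       (\<lambda>h. bregman_dist_sq (sparse_psi lam) (xs h) (x h) (argmin_set (avg_loss A b I)))"

end

theory Submission
  imports Defs
begin

text \<open>
  Each step decreases the Bregman distance to any feasible point by a multiple of the loss of the
  sampled block, provided \<open>\<sigma>\<^sub>m\<^sub>a\<^sub>x\<^sup>2\<close> of the block is controlled; averaging over the blocks turns the block loss into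
  \<open>F\<close>, and the growth condition gives the linear rate.

  The spectral bound for random blocks is a matrix Chernoff bound without matrix exponentials. For a
  positive operator \<open>S\<close> and a unit vector \<open>a\<close> the moments \<open>s\<^sub>p = \<langle>a, S\<^sup>p a\<rangle>\<close> are log-convex with
  \<open>s\<^sub>0 = 1\<close>, so \<open>s\<^sub>i s\<^sub>j \<le> s\<^sub>i\<^sub>+\<^sub>j\<close>. Expanding a power of \<open>S + a a\<^sup>T\<close> and merging factors gives
  \<open>tr (S + a a\<^sup>T)\<^sup>p \<le> tr S\<^sup>p + \<langle>a, ((1 + S)\<^sup>p - S\<^sup>p) a\<rangle>\<close>. Averaged over the next row drawn without replacement,
  this bounds the growth of the truncated exponential trace, and Markov's inequality concludes.
\<close>

section \<open>Moments of positive operators under rank-one updates\<close>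

text \<open>The obstacle is that \<open>S\<close> and the projection a a^T do not commute, so the
  exponential of their sum does not factor. The trace of a word in both is nevertheless a product of
  scalar moments of \<open>S\<close>, one for each gap between cyclically consecutive copies of a
  a^T. Merging two moments has the effect of replacing one copy by the identity; once a single copy
  is left, only the commuting operators \<open>S\<close> and 1 + S remain. Divided by p! and summed
  over all p, the trace bound reads tr exp(S + a a^T) <= tr exp(S) + (e - 1) <a, exp(S) a>. Since
  exp(a a^T) = 1 + (e - 1) a a^T for a unit vector, this is the Golden-Thompson inequality for a
  rank-one projection, and it is the origin of the constant \<open>exp 1 - 1\<close> in the later
  estimates.\<close>

lemma self_adjoint_funpow:
  fixes S :: "'a::real_inner \<Rightarrow> 'a"
  assumes "\<And>x y. x \<bullet> S y = S x \<bullet> y"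
  shows "x \<bullet> (S ^^ p) y = (S ^^ p) x \<bullet> y"
proof (induction p arbitrary: x)
  case (Suc p)
  have "x \<bullet> (S ^^ Suc p) y = S x \<bullet> (S ^^ p) y" by (simp add: assms)
  also have "\<dots> = (S ^^ p) (S x) \<bullet> y" by (rule Suc.IH)
  finally show ?case by (simp add: funpow_swap1)
qed simp

text \<open>Degenerate forms are included: if \<open>y \<bullet> S y = 0\<close>, then
  \<open>y\<close> is orthogonal to everything in this form. The singular value part recognizes an
  eigenvector in this way.\<close>

lemma psd_Cauchy_Schwarz:
  fixes S :: "'a::real_inner \<Rightarrow> 'a"
  assumes "linear S" "\<And>x y. x \<bullet> S y = S x \<bullet> y" "\<And>x. 0 \<le> x \<bullet> S x"
  shows "(x \<bullet> S y)\<^sup>2 \<le> (x \<bullet> S x) * (y \<bullet> S y)"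
proof -
  let ?a = "y \<bullet> S y" and ?b = "x \<bullet> S y" and ?c = "x \<bullet> S x"
  have q: "0 \<le> ?c + 2 * r * ?b + r\<^sup>2 * ?a" for r
  proof -
    have "y \<bullet> S x = ?b" by (simp only: assms(2)[of y x] inner_commute)
    then have "(x + r *\<^sub>R y) \<bullet> S (x + r *\<^sub>R y) = ?c + 2 * r * ?b + r\<^sup>2 * ?a"
      by (simp add: linear_add[OF assms(1)] linear_scale[OF assms(1)] inner_add_left
          inner_add_right power2_eq_square algebra_simps)
    then show ?thesis using assms(3)[of "x + r *\<^sub>R y"] by simp
  qed
  show ?thesis
  proof (cases "?a = 0")
    case True
    have "?b = 0"
    proof (rule ccontr)
      assume "?b \<noteq> 0"
      \<comment> \<open>This value of \<open>r\<close> makes the affine function in \<open>q\<close>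
        equal to -1.\<close>
      then have "2 * (- (?c + 1) / (2 * ?b)) * ?b = - (?c + 1)" by simp
      then show False using q[of "- (?c + 1) / (2 * ?b)"] True by simp
    qed
    then show ?thesis using True by simp
  next
    case False
    then have a: "?a > 0" using assms(3)[of y] by simp
    have "0 \<le> ?a * (?c + 2 * (- ?b / ?a) * ?b + (- ?b / ?a)\<^sup>2 * ?a)"
      using q[of "- ?b / ?a"] a by simp
    also have "\<dots> = ?c * ?a - ?b\<^sup>2"
      using a by (simp add: field_simps power2_eq_square)
    finally show ?thesis by simp
  qed
qed

text \<open>Log-convexity makes the ratios \<open>s (Suc p) / s p\<close> increase, so passing from
  \<open>j\<close> to \<open>Suc j\<close> gains at most as much as passing from
  \<open>i + j\<close> to \<open>Suc (i + j)\<close>. If \<open>s 1 = 0\<close>, it forces all later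
  terms to vanish, and no ratio has to be formed.\<close>

lemma log_convex_supermultiplicative:
  fixes s :: "nat \<Rightarrow> real"
  assumes s0: "s 0 = 1" and nn: "\<And>p. 0 \<le> s p"
    and lc: "\<And>p. (s (Suc p))\<^sup>2 \<le> s p * s (Suc (Suc p))"
  shows "s i * s j \<le> s (i + j)"
proof (cases "s 1 = 0")
  case True
  have z: "s (Suc p) = 0" for p
  proof (induction p)
    case (Suc p)
    then show ?case using lc[of "Suc p"] by simp
  qed (use True in simp)
  show ?thesis by (cases i; cases j) (simp_all add: z s0)
next
  case False
  have pos2: "0 < s p \<and> 0 < s (Suc p)" for p
  proof (induction p)
    case 0
    then show ?case using s0 False nn[of 1] by simp
  next
    case (Suc p)
    then have "0 < s p * s (Suc (Suc p))" using lc[of p] by (smt (verit) zero_less_power)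
    then show ?case using Suc by (simp add: zero_less_mult_iff)
  qed
  then have pos: "0 < s p" for p by blast
  have "incseq (\<lambda>p. s (Suc p) / s p)"
  proof (rule incseq_SucI)
    fix p
    show "s (Suc p) / s p \<le> s (Suc (Suc p)) / s (Suc p)"
      using lc[of p] pos[of p] pos[of "Suc p"]
      by (simp add: divide_simps power2_eq_square mult.commute)
  qed
  then have ratio: "s (Suc j) / s j \<le> s (Suc (i + j)) / s (i + j)" for j
    by (simp add: incseq_def)
  show ?thesis
  proof (induction j)
    case (Suc j)
    have "s i * s (Suc j) = (s i * s j) * (s (Suc j) / s j)" using pos[of j] by simp
    also have "\<dots> \<le> s (i + j) * (s (Suc (i + j)) / s (i + j))"
      using Suc ratio[of j] pos by (intro mult_mono) (auto intro: less_imp_le divide_nonneg_pos)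
    also have "\<dots> = s (i + Suc j)" using pos[of "i + j"] by simp
    finally show ?case .
  qed (simp add: s0)
qed

locale psd_operator =
  fixes S :: "'a::real_inner \<Rightarrow> 'a"
  assumes lin: "linear S"
    and adj: "\<And>x y. x \<bullet> S y = S x \<bullet> y"
    and psd: "\<And>x. 0 \<le> x \<bullet> S x"
begin

lemma pow_adj: "x \<bullet> (S ^^ p) y = (S ^^ p) x \<bullet> y"
  by (rule self_adjoint_funpow) (rule adj)

lemma moment_even: "x \<bullet> (S ^^ (p + p)) x = (S ^^ p) x \<bullet> (S ^^ p) x"
  by (simp add: funpow_add pow_adj[of x p])

lemma moment_odd: "x \<bullet> (S ^^ Suc (p + p)) x = (S ^^ p) x \<bullet> S ((S ^^ p) x)"
proof -
  have "x \<bullet> (S ^^ Suc (p + p)) x = x \<bullet> (S ^^ p) (S ((S ^^ p) x))"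
    by (simp add: funpow_add funpow_swap1)
  then show ?thesis by (simp only: pow_adj)
qed

lemma moment_nonneg: "0 \<le> x \<bullet> (S ^^ p) x"
proof (cases "even p")
  case True
  then obtain r where "p = r + r" by (metis evenE mult_2)
  then show ?thesis by (simp add: moment_even)
next
  case False
  then obtain r where "p = Suc (r + r)" by (metis oddE mult_2 Suc_eq_plus1)
  then show ?thesis by (simp only: moment_odd psd)
qed

text \<open>Splitting the powers symmetrically avoids a spectral decomposition. With u = S^r x, this
  is Cauchy-Schwarz for u and S u: in the given inner product for even \<open>p\<close>, in the
  semi-inner product induced by \<open>S\<close> for odd \<open>p\<close>.\<close>

lemma moment_log_convex:
  "(x \<bullet> (S ^^ Suc p) x)\<^sup>2 \<le> (x \<bullet> (S ^^ p) x) * (x \<bullet> (S ^^ Suc (Suc p)) x)"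
proof (cases "even p")
  case True
  then obtain r where p: "p = r + r" by (metis evenE mult_2)
  have "Suc (Suc p) = Suc r + Suc r" using p by simp
  then have e: "x \<bullet> (S ^^ Suc (Suc p)) x = S ((S ^^ r) x) \<bullet> S ((S ^^ r) x)"
    by (simp only: moment_even) simp
  show ?thesis unfolding e unfolding p moment_even moment_odd
    by (rule Cauchy_Schwarz_ineq)
next
  case False
  then obtain r where p: "p = Suc (r + r)" by (metis oddE mult_2 Suc_eq_plus1)
  have "Suc p = Suc r + Suc r" using p by simp
  then have e1: "x \<bullet> (S ^^ Suc p) x = S ((S ^^ r) x) \<bullet> S ((S ^^ r) x)"
    by (simp only: moment_even) simp
  have "Suc (Suc p) = Suc (Suc r + Suc r)" using p by simp
  then have e2: "x \<bullet> (S ^^ Suc (Suc p)) x = S ((S ^^ r) x) \<bullet> S (S ((S ^^ r) x))"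
    by (simp only: moment_odd) simp
  have e3: "S ((S ^^ r) x) \<bullet> S ((S ^^ r) x) = (S ^^ r) x \<bullet> S (S ((S ^^ r) x))"
    by (rule adj[symmetric])
  show ?thesis unfolding e1 e2 e3 unfolding p moment_odd
    by (rule psd_Cauchy_Schwarz[OF lin adj psd])
qed

lemma moment_supermult:
  assumes "norm x = 1"
  shows "(x \<bullet> (S ^^ i) x) * (x \<bullet> (S ^^ j) x) \<le> x \<bullet> (S ^^ (i + j)) x"
  using log_convex_supermultiplicative[of "\<lambda>p. x \<bullet> (S ^^ p) x"] assms moment_nonneg moment_log_convex
  by (simp add: dot_square_norm)

text \<open>Jensen's inequality for the spectral distribution of \<open>x\<close>, read off from
  supermultiplicativity.\<close>

lemma moment_ge_power:
  assumes "norm x = 1"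
  shows "(x \<bullet> S x) ^ p \<le> x \<bullet> (S ^^ p) x"
proof (induction p)
  case (Suc p)
  have "(x \<bullet> S x) ^ Suc p \<le> (x \<bullet> (S ^^ 1) x) * (x \<bullet> (S ^^ p) x)"
    using Suc psd[of x] by (simp add: mult_left_mono)
  also have "\<dots> \<le> x \<bullet> (S ^^ Suc p) x"
    using moment_supermult[OF assms, of 1 p] by simp
  finally show ?case .
qed (use assms in \<open>simp add: dot_square_norm\<close>)

end

text \<open>The operator 1 + S. It takes the place of S + a a^T in upper bounds for moments at
  \<open>a\<close> and, unlike that operator, commutes with \<open>S\<close>.\<close>

definition shift_op :: "('a::real_vector \<Rightarrow> 'a) \<Rightarrow> 'a \<Rightarrow> 'a" where
  "shift_op S x = S x + x"

lemma shift_op_pow_telescope: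
  assumes "linear S"
  shows "(shift_op S ^^ q) y = (S ^^ q) y + (\<Sum>j<q. (S ^^ j) ((shift_op S ^^ (q - Suc j)) y))"
proof (induction q)
  case (Suc q)
  have "(shift_op S ^^ Suc q) y = S ((shift_op S ^^ q) y) + (shift_op S ^^ q) y"
    by (simp add: shift_op_def)
  also have "S ((shift_op S ^^ q) y) =
      (S ^^ Suc q) y + (\<Sum>j<q. (S ^^ Suc j) ((shift_op S ^^ (q - Suc j)) y))"
    by (subst Suc) (simp add: linear_add[OF assms] linear_sum[OF assms])
  also have "\<dots> + (shift_op S ^^ q) y
      = (S ^^ Suc q) y + (\<Sum>j<Suc q. (S ^^ j) ((shift_op S ^^ (Suc q - Suc j)) y))"
    by (subst sum.lessThan_Suc_shift) (simp add: algebra_simps)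
  finally show ?case .
qed simp

lemma shift_op_pow_binomial:
  assumes "linear S"
  shows "(shift_op S ^^ p) x = (\<Sum>k\<le>p. real (p choose k) *\<^sub>R (S ^^ k) x)"
proof (induction p)
  case (Suc p)
  have "(\<Sum>k\<le>Suc p. real (Suc p choose k) *\<^sub>R (S ^^ k) x)
      = x + (\<Sum>k\<le>p. real (Suc p choose Suc k) *\<^sub>R (S ^^ Suc k) x)"
    by (subst sum.atMost_Suc_shift) simp
  also have "\<dots> = x + (\<Sum>k\<le>p. real (p choose Suc k) *\<^sub>R (S ^^ Suc k) x)
      + (\<Sum>k\<le>p. real (p choose k) *\<^sub>R (S ^^ Suc k) x)"
    by (simp add: sum.distrib algebra_simps)
  also have "x + (\<Sum>k\<le>p. real (p choose Suc k) *\<^sub>R (S ^^ Suc k) x)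
      = (\<Sum>k\<le>Suc p. real (p choose k) *\<^sub>R (S ^^ k) x)"
    by (subst sum.atMost_Suc_shift) simp
  also have "\<dots> = (shift_op S ^^ p) x" by (simp add: Suc)
  also have "(\<Sum>k\<le>p. real (p choose k) *\<^sub>R (S ^^ Suc k) x) = S ((shift_op S ^^ p) x)"
    by (simp add: Suc linear_sum[OF assms] linear_scale[OF assms])
  finally show ?case by (simp add: shift_op_def[of S "(shift_op S ^^ p) x"])
qed simp

lemma shift_op_pow_commute:
  assumes "linear S"
  shows "(S ^^ i) ((shift_op S ^^ k) x) = (shift_op S ^^ k) ((S ^^ i) x)"
proof -
  have 1: "S (shift_op S x) = shift_op S (S x)" for x
    by (simp add: shift_op_def linear_add[OF assms])
  have 2: "S ((shift_op S ^^ k) x) = (shift_op S ^^ k) (S x)" for x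
    by (induction k) (simp_all add: 1)
  show ?thesis by (induction i) (simp_all add: 2)
qed

definition rank_one_update :: "('a::real_inner \<Rightarrow> 'a) \<Rightarrow> 'a \<Rightarrow> 'a \<Rightarrow> 'a" where
  "rank_one_update S a x = S x + (a \<bullet> x) *\<^sub>R a"

text \<open>Sorts the words in S and a a^T by the number \<open>j\<close> of factors S to the left
  of the leftmost a a^T. \<open>shift_op_pow_telescope\<close> is the same expansion with the
  identity instead of a a^T, so the two can be compared term by term.\<close>

lemma rank_one_update_pow_telescope:
  assumes "linear S"
  shows "(rank_one_update S a ^^ q) x = (S ^^ q) x +
    (\<Sum>j<q. (a \<bullet> (rank_one_update S a ^^ (q - Suc j)) x) *\<^sub>R (S ^^ j) a)"
proof (induction q)
  case (Suc q)
  let ?T = "rank_one_update S a"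
  have "(?T ^^ Suc q) x = S ((?T ^^ q) x) + (a \<bullet> (?T ^^ q) x) *\<^sub>R a"
    by (simp add: rank_one_update_def)
  also have "S ((?T ^^ q) x) =
      (S ^^ Suc q) x + (\<Sum>j<q. (a \<bullet> (?T ^^ (q - Suc j)) x) *\<^sub>R (S ^^ Suc j) a)"
    by (subst Suc) (simp add: linear_add[OF assms] linear_sum[OF assms] linear_scale[OF assms])
  also have "\<dots> + (a \<bullet> (?T ^^ q) x) *\<^sub>R a
      = (S ^^ Suc q) x + (\<Sum>j<Suc q. (a \<bullet> (?T ^^ (Suc q - Suc j)) x) *\<^sub>R (S ^^ j) a)"
    by (subst sum.lessThan_Suc_shift) (simp add: algebra_simps)
  finally show ?case .
qed simp

definition op_trace :: "('a::euclidean_space \<Rightarrow> 'a) \<Rightarrow> real" where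
  "op_trace f = (\<Sum>b\<in>Basis. b \<bullet> f b)"

context psd_operator
begin

lemma psd_operator_rank_one_update: "psd_operator (rank_one_update S a)"
proof (rule psd_operator.intro)
  show "linear (rank_one_update S a)"
    by (rule linearI)
      (simp_all add: rank_one_update_def linear_add[OF lin] linear_scale[OF lin] inner_add_right algebra_simps)
  show "x \<bullet> rank_one_update S a y = rank_one_update S a x \<bullet> y" for x y
    by (simp add: rank_one_update_def inner_add_left inner_add_right adj[of x y] inner_commute[of x a])
  show "0 \<le> x \<bullet> rank_one_update S a x" for x
    using psd[of x] by (simp add: rank_one_update_def inner_add_right inner_commute)
qed

text \<open>A power of 1 + S is a combination of powers of S with nonnegative coefficients, so
  moments can still be merged under it.\<close>

lemma moment_supermult_shift:
  assumes "norm a = 1"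
  shows "(a \<bullet> (shift_op S ^^ k) ((S ^^ w) a)) * (a \<bullet> (S ^^ v) a)
    \<le> a \<bullet> (shift_op S ^^ k) ((S ^^ (w + v)) a)"
proof (induction k arbitrary: w)
  case 0
  show ?case using moment_supermult[OF assms] by simp
next
  case (Suc k)
  have e: "(shift_op S ^^ Suc k) ((S ^^ u) a)
      = (shift_op S ^^ k) ((S ^^ Suc u) a) + (shift_op S ^^ k) ((S ^^ u) a)" for u
    unfolding funpow.simps(2)[of k "shift_op S"] comp_apply shift_op_def[of S "(shift_op S ^^ k) _"]
    using shift_op_pow_commute[OF lin, of 1 k] by simp
  show ?case unfolding e using Suc.IH[of w] Suc.IH[of "Suc w"]
    by (simp add: inner_add_right distrib_right)
qed

text \<open>The induction hypothesis at \<open>i = 0\<close> bounds the scalar factor of each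
  telescoping summand, merging absorbs it into the remaining moment, and the new summands add up to
  (1 + S)^q. The trace bound uses the result for all \<open>i\<close>.\<close>

lemma rank_one_moment_le:
  assumes "norm a = 1"
  shows "((rank_one_update S a ^^ q) a) \<bullet> ((S ^^ i) a) \<le> a \<bullet> (shift_op S ^^ q) ((S ^^ i) a)"
proof (induction q arbitrary: i rule: less_induct)
  case (less q)
  let ?T = "rank_one_update S a"
  have s: "(S ^^ j) a \<bullet> (S ^^ i) a = a \<bullet> (S ^^ (j + i)) a" for j
    by (simp add: pow_adj[symmetric] funpow_add)
  have "((?T ^^ q) a) \<bullet> ((S ^^ i) a) =
      a \<bullet> (S ^^ (q + i)) a + (\<Sum>j<q. (a \<bullet> (?T ^^ (q - Suc j)) a) * (a \<bullet> (S ^^ (j + i)) a))"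
    by (subst rank_one_update_pow_telescope[OF lin])
      (simp add: inner_add_left inner_sum_left s)
  also have "\<dots> \<le> a \<bullet> (S ^^ (q + i)) a +
      (\<Sum>j<q. a \<bullet> (shift_op S ^^ (q - Suc j)) ((S ^^ (j + i)) a))"
  proof (intro add_left_mono sum_mono)
    fix j assume "j \<in> {..<q}"
    then have "q - Suc j < q" by auto
    from less.IH[OF this, of 0]
    have "(a \<bullet> (?T ^^ (q - Suc j)) a) * (a \<bullet> (S ^^ (j + i)) a)
        \<le> (a \<bullet> (shift_op S ^^ (q - Suc j)) ((S ^^ 0) a)) * (a \<bullet> (S ^^ (j + i)) a)"
      using moment_nonneg by (intro mult_right_mono) (simp_all add: inner_commute)
    also have "\<dots> \<le> a \<bullet> (shift_op S ^^ (q - Suc j)) ((S ^^ (j + i)) a)"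
      using moment_supermult_shift[OF assms, of _ 0] by simp
    finally show "(a \<bullet> (?T ^^ (q - Suc j)) a) * (a \<bullet> (S ^^ (j + i)) a)
        \<le> a \<bullet> (shift_op S ^^ (q - Suc j)) ((S ^^ (j + i)) a)" .
  qed
  also have "\<dots> = a \<bullet> (shift_op S ^^ q) ((S ^^ i) a)"
    by (simp add: shift_op_pow_telescope[OF lin, of q "(S ^^ i) a"] inner_add_right
        inner_sum_right funpow_add shift_op_pow_commute[OF lin])
  finally show ?case .
qed

end

lemma op_trace_rank_one_update_le:
  fixes S :: "'a::euclidean_space \<Rightarrow> 'a"
  assumes "psd_operator S" and a: "norm a = 1"
  shows "op_trace (rank_one_update S a ^^ p) \<le>
    op_trace (S ^^ p) + (\<Sum>k<p. real (p choose k) * (a \<bullet> (S ^^ k) a))"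
proof -
  interpret psd_operator S by fact
  let ?T = "rank_one_update S a"
  interpret T: psd_operator ?T by (rule psd_operator_rank_one_update)
  have "op_trace (?T ^^ p) = op_trace (S ^^ p) +
      (\<Sum>b\<in>Basis. \<Sum>j<p. ((?T ^^ (p - Suc j)) a \<bullet> b) * ((S ^^ j) a \<bullet> b))"
  proof -
    have "b \<bullet> (?T ^^ p) b = b \<bullet> (S ^^ p) b +
        (\<Sum>j<p. ((?T ^^ (p - Suc j)) a \<bullet> b) * ((S ^^ j) a \<bullet> b))" for b
      unfolding rank_one_update_pow_telescope[OF lin, where q = p and x = b]
      by (simp only: inner_add_right inner_sum_right inner_scaleR_right T.pow_adj[of a]
          inner_commute[of b "(S ^^ _) a"])
    then show ?thesis by (simp add: op_trace_def sum.distrib)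
  qed
  \<comment> \<open>The trace of S^j a a^T T^(p-1-j) is an inner product of two vectors, expanded in
    the orthonormal basis.\<close>
  also have "(\<Sum>b\<in>Basis. \<Sum>j<p. ((?T ^^ (p - Suc j)) a \<bullet> b) * ((S ^^ j) a \<bullet> b))
      = (\<Sum>j<p. (?T ^^ (p - Suc j)) a \<bullet> (S ^^ j) a)"
    by (subst sum.swap) (simp add: euclidean_inner[symmetric])
  also have "\<dots> \<le> (\<Sum>j<p. a \<bullet> (shift_op S ^^ (p - Suc j)) ((S ^^ j) a))"
    by (intro sum_mono rank_one_moment_le a)
  also have "\<dots> = a \<bullet> (shift_op S ^^ p) a - a \<bullet> (S ^^ p) a"
    by (simp add: shift_op_pow_telescope[OF lin, of p a] inner_add_right
        inner_sum_right shift_op_pow_commute[OF lin])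
  also have "\<dots> = (\<Sum>k<p. real (p choose k) * (a \<bullet> (S ^^ k) a))"
    by (simp add: shift_op_pow_binomial[OF lin, of p a] inner_sum_right
        inner_add_right lessThan_Suc_atMost[symmetric])
  finally show ?thesis by simp
qed

section \<open>Trace moments of frame operators\<close>

definition frame_op :: "('m \<Rightarrow> 'a::real_inner) \<Rightarrow> 'm set \<Rightarrow> 'a \<Rightarrow> 'a" where
  "frame_op a J x = (\<Sum>j\<in>J. (a j \<bullet> x) *\<^sub>R a j)"

lemma inner_frame_op: "x \<bullet> frame_op a J y = (\<Sum>j\<in>J. (a j \<bullet> x) * (a j \<bullet> y))"
  by (simp add: frame_op_def inner_sum_right inner_commute mult.commute)

lemma psd_operator_frame_op: "psd_operator (frame_op a J)"
proof (rule psd_operator.intro)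
  show "linear (frame_op a J)"
    by (rule linearI)
      (simp_all add: frame_op_def inner_add_right scaleR_left_distrib sum.distrib scaleR_sum_right)
  show "x \<bullet> frame_op a J y = frame_op a J x \<bullet> y" for x y
    unfolding inner_commute[of "frame_op a J x" y] inner_frame_op by (simp add: mult.commute)
  show "0 \<le> x \<bullet> frame_op a J x" for x
    unfolding inner_frame_op by (intro sum_nonneg) simp
qed

lemma frame_op_insert:
  "finite J \<Longrightarrow> j \<notin> J \<Longrightarrow> frame_op a (insert j J) = rank_one_update (frame_op a J) (a j)"
  by (auto simp: frame_op_def rank_one_update_def)

lemma norm_sq_Basis: "(norm (x::'a::euclidean_space))\<^sup>2 = (\<Sum>b\<in>Basis. (x \<bullet> b)\<^sup>2)"
  unfolding power2_norm_eq_inner by (subst euclidean_inner) (simp only: power2_eq_square)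

text \<open>Traces of powers, here and for odd exponents, become sums of squared norms; trace
  inequalities then reduce to inequalities for single vectors.\<close>

lemma op_trace_frame_op_even:
  fixes a :: "'m \<Rightarrow> 'a::euclidean_space"
  shows "op_trace (frame_op a J ^^ (r + r)) = (\<Sum>b\<in>Basis. (norm ((frame_op a J ^^ r) b))\<^sup>2)"
proof -
  interpret psd_operator "frame_op a J" by (rule psd_operator_frame_op)
  show ?thesis unfolding op_trace_def moment_even by (simp add: power2_norm_eq_inner)
qed

lemma op_trace_frame_op_odd:
  fixes a :: "'m \<Rightarrow> 'a::euclidean_space"
  shows "op_trace (frame_op a J ^^ Suc (r + r)) = (\<Sum>k\<in>J. (norm ((frame_op a J ^^ r) (a k)))\<^sup>2)"
proof -
  interpret psd_operator "frame_op a J" by (rule psd_operator_frame_op)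
  have "op_trace (frame_op a J ^^ Suc (r + r))
      = (\<Sum>b\<in>Basis. \<Sum>k\<in>J. (a k \<bullet> (frame_op a J ^^ r) b)\<^sup>2)"
    unfolding op_trace_def moment_odd inner_frame_op by (simp add: power2_eq_square)
  also have "\<dots> = (\<Sum>k\<in>J. \<Sum>b\<in>Basis. ((frame_op a J ^^ r) (a k) \<bullet> b)\<^sup>2)"
    by (subst sum.swap) (simp only: pow_adj)
  finally show ?thesis by (simp add: norm_sq_Basis)
qed

lemma moment_le_op_trace_frame_op:
  fixes a :: "'m \<Rightarrow> 'a::euclidean_space"
  assumes x: "norm x = 1"
  shows "x \<bullet> (frame_op a J ^^ p) x \<le> op_trace (frame_op a J ^^ p)"
proof -
  interpret psd_operator "frame_op a J" by (rule psd_operator_frame_op)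
  have le: "(x \<bullet> y)\<^sup>2 \<le> (norm y)\<^sup>2" for y
    using Cauchy_Schwarz_ineq2[of x y] x by (simp add: abs_le_square_iff[symmetric])
  show ?thesis
  proof (cases "even p")
    case True
    then obtain r where p: "p = r + r" by (metis evenE mult_2)
    have "x \<bullet> (frame_op a J ^^ p) x = (\<Sum>b\<in>Basis. (x \<bullet> (frame_op a J ^^ r) b)\<^sup>2)"
      unfolding p moment_even power2_norm_eq_inner[symmetric] norm_sq_Basis by (simp only: pow_adj)
    also have "\<dots> \<le> op_trace (frame_op a J ^^ p)"
      unfolding p op_trace_frame_op_even by (intro sum_mono le)
    finally show ?thesis .
  next
    case False
    then obtain r where p: "p = Suc (r + r)" by (metis oddE mult_2 Suc_eq_plus1)
    have "x \<bullet> (frame_op a J ^^ p) x = (\<Sum>k\<in>J. (x \<bullet> (frame_op a J ^^ r) (a k))\<^sup>2)"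
      unfolding p moment_odd inner_frame_op pow_adj[of x]
      by (simp add: power2_eq_square pow_adj[symmetric] inner_commute[of "a _"])
    also have "\<dots> \<le> op_trace (frame_op a J ^^ p)"
      unfolding p op_trace_frame_op_odd by (intro sum_mono le)
    finally show ?thesis .
  qed
qed

text \<open>In operator terms, tr (M S^p) <= s tr (S^p), where M is the sum of all a_j a_j^T and M
  <= s. The sums of squares allow \<open>fr\<close> to be applied to one vector at a time.\<close>

lemma sum_moments_le_op_trace_frame_op:
  fixes a :: "'m::finite \<Rightarrow> 'a::euclidean_space"
  assumes fr: "\<And>x. (\<Sum>j\<in>UNIV. (a j \<bullet> x)\<^sup>2) \<le> s * (norm x)\<^sup>2"
  shows "(\<Sum>j\<in>UNIV. a j \<bullet> (frame_op a J ^^ p) (a j)) \<le> s * op_trace (frame_op a J ^^ p)"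
proof -
  interpret psd_operator "frame_op a J" by (rule psd_operator_frame_op)
  show ?thesis
  proof (cases "even p")
    case True
    then obtain r where p: "p = r + r" by (metis evenE mult_2)
    have "(\<Sum>j\<in>UNIV. a j \<bullet> (frame_op a J ^^ p) (a j))
        = (\<Sum>b\<in>Basis. \<Sum>j\<in>UNIV. (a j \<bullet> (frame_op a J ^^ r) b)\<^sup>2)"
      unfolding p moment_even power2_norm_eq_inner[symmetric] norm_sq_Basis
      by (subst sum.swap) (simp only: pow_adj)
    also have "\<dots> \<le> (\<Sum>b\<in>Basis. s * (norm ((frame_op a J ^^ r) b))\<^sup>2)"
      by (intro sum_mono fr)
    finally show ?thesis unfolding p op_trace_frame_op_even by (simp add: sum_distrib_left)
  next
    case False
    then obtain r where p: "p = Suc (r + r)" by (metis oddE mult_2 Suc_eq_plus1)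
    have sym: "a k \<bullet> (frame_op a J ^^ r) (a j) = a j \<bullet> (frame_op a J ^^ r) (a k)" for j k
      by (subst pow_adj) (rule inner_commute)
    have "(\<Sum>j\<in>UNIV. a j \<bullet> (frame_op a J ^^ p) (a j))
        = (\<Sum>k\<in>J. \<Sum>j\<in>UNIV. (a j \<bullet> (frame_op a J ^^ r) (a k))\<^sup>2)"
      unfolding p moment_odd inner_frame_op
      by (subst sum.swap) (intro sum.cong refl, simp only: power2_eq_square sym)
    also have "\<dots> \<le> (\<Sum>k\<in>J. s * (norm ((frame_op a J ^^ r) (a k)))\<^sup>2)"
      by (intro sum_mono fr)
    finally show ?thesis unfolding p op_trace_frame_op_odd by (simp add: sum_distrib_left)
  qed
qed

section \<open>Truncated trace exponentials and the insertion of one more row\<close>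

definition trace_moment :: "('m::finite \<Rightarrow> 'a::euclidean_space) \<Rightarrow> nat \<Rightarrow> 'm set \<Rightarrow> real" where
  "trace_moment a p J = (if p = 0 then real CARD('m) else op_trace (frame_op a J ^^ p))"

lemma trace_moment_nonneg: "0 \<le> trace_moment a p J"
proof -
  interpret psd_operator "frame_op a J" by (rule psd_operator_frame_op)
  show ?thesis by (auto simp: trace_moment_def op_trace_def intro!: sum_nonneg moment_nonneg)
qed

text \<open>Summed over the rows outside \<open>J\<close>, the moments in the rank-one bound become
  traces; being nonnegative, they may first be summed over all rows.\<close>

lemma sum_trace_moment_insert_le:
  fixes a :: "'m::finite \<Rightarrow> 'a::euclidean_space"
  assumes unit: "\<And>j. norm (a j) = 1"
    and fr: "\<And>x. (\<Sum>j\<in>UNIV. (a j \<bullet> x)\<^sup>2) \<le> s * (norm x)\<^sup>2" and s1: "1 \<le> s"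
  shows "(\<Sum>j\<in>-J. trace_moment a p (insert j J)) \<le>
    real (card (-J)) * trace_moment a p J + s * (\<Sum>k<p. real (p choose k) * trace_moment a k J)"
proof (cases "p = 0")
  case True
  then show ?thesis by (simp add: trace_moment_def)
next
  case False
  interpret psd_operator "frame_op a J" by (rule psd_operator_frame_op)
  have mom: "(\<Sum>j\<in>-J. a j \<bullet> (frame_op a J ^^ k) (a j)) \<le> s * trace_moment a k J" for k
  proof -
    have "(\<Sum>j\<in>-J. a j \<bullet> (frame_op a J ^^ k) (a j)) \<le> (\<Sum>j\<in>UNIV. a j \<bullet> (frame_op a J ^^ k) (a j))"
      by (intro sum_mono2) (auto simp: moment_nonneg)
    also have "\<dots> \<le> s * trace_moment a k J"
    \<comment> \<open>At \<open>k = 0\<close> the sum counts the unit vectors, which is the value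
      assigned to \<open>trace_moment\<close> at 0; here \<open>1 \<le> s\<close> enters.\<close>
    proof (cases "k = 0")
      case True
      then show ?thesis using unit s1 by (simp add: trace_moment_def dot_square_norm)
    next
      case False
      then show ?thesis
        using sum_moments_le_op_trace_frame_op[OF fr] by (simp add: trace_moment_def)
    qed
    finally show ?thesis .
  qed
  have "(\<Sum>j\<in>-J. trace_moment a p (insert j J)) \<le>
      (\<Sum>j\<in>-J. trace_moment a p J + (\<Sum>k<p. real (p choose k) * (a j \<bullet> (frame_op a J ^^ k) (a j))))"
  proof (intro sum_mono)
    fix j assume "j \<in> - J"
    then show "trace_moment a p (insert j J) \<le>
        trace_moment a p J + (\<Sum>k<p. real (p choose k) * (a j \<bullet> (frame_op a J ^^ k) (a j)))"
      using False op_trace_rank_one_update_le[OF psd_operator_frame_op unit, where p = p]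
      by (simp add: trace_moment_def frame_op_insert)
  qed
  also have "\<dots> = real (card (-J)) * trace_moment a p J +
      (\<Sum>k<p. real (p choose k) * (\<Sum>j\<in>-J. a j \<bullet> (frame_op a J ^^ k) (a j)))"
    by (simp add: sum.distrib sum_distrib_left sum.swap[of _ "- J"])
  also have "(\<Sum>k<p. real (p choose k) * (\<Sum>j\<in>-J. a j \<bullet> (frame_op a J ^^ k) (a j)))
      \<le> (\<Sum>k<p. real (p choose k) * (s * trace_moment a k J))"
    by (intro sum_mono mult_left_mono mom) simp
  also have "\<dots> = s * (\<Sum>k<p. real (p choose k) * trace_moment a k J)"
    by (simp add: sum_distrib_left algebra_simps)
  finally show ?thesis by simp
qed

text \<open>Working with truncated exponential series avoids matrix exponentials and convergence questions.
  The constant term is the number of vectors instead of the dimension of the space, so that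
  the bounds below are dimension-free.\<close>

definition trace_exp :: "('m::finite \<Rightarrow> 'a::euclidean_space) \<Rightarrow> nat \<Rightarrow> 'm set \<Rightarrow> real" where
  "trace_exp a n J = (\<Sum>p\<le>n. trace_moment a p J / fact p)"

lemma trace_exp_nonneg: "0 \<le> trace_exp a n J"
  by (auto simp: trace_exp_def intro!: sum_nonneg divide_nonneg_pos trace_moment_nonneg)

lemma trace_exp_empty:
  fixes a :: "'m::finite \<Rightarrow> 'a::euclidean_space"
  shows "trace_exp a n {} = real CARD('m)"
proof -
  have "(frame_op a {} ^^ Suc p) x = 0" for p x by (simp add: frame_op_def)
  then have "trace_moment a (Suc p) {} = 0" for p
    unfolding trace_moment_def op_trace_def by (simp del: funpow.simps)
  then show ?thesis by (simp add: trace_exp_def sum.atMost_shift trace_moment_def[of a 0])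
qed

lemma sum_inverse_fact_le: "(\<Sum>r=1..n. 1 / fact r :: real) \<le> exp 1 - 1"
proof -
  have "1 + (\<Sum>r=1..n. 1 / fact r :: real) = (\<Sum>r\<in>insert 0 {1..n}. 1 / fact r)"
    by (subst sum.insert) auto
  also have "\<dots> \<le> (\<Sum>r. 1 / fact r)"
    using summable_exp[of "1::real"]
    by (intro sum_le_suminf) (auto simp: divide_inverse)
  also have "\<dots> = exp 1" by (simp add: exp_def divide_inverse)
  finally show ?thesis by simp
qed

text \<open>With p = k + r, the binomial coefficient divided by p! is 1 / (k! r!), so the double sum
  almost factors; the sum over r >= 1 is at most e - 1. The order \<open>n\<close> is the same on
  both sides because the bound for degree p involves no higher degree.\<close>

lemma sum_trace_exp_insert_le:
  fixes a :: "'m::finite \<Rightarrow> 'a::euclidean_space"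
  assumes unit: "\<And>j. norm (a j) = 1"
    and fr: "\<And>x. (\<Sum>j\<in>UNIV. (a j \<bullet> x)\<^sup>2) \<le> s * (norm x)\<^sup>2" and s1: "1 \<le> s"
  shows "(\<Sum>j\<in>-J. trace_exp a n (insert j J)) \<le> (real (card (-J)) + s * (exp 1 - 1)) * trace_exp a n J"
proof -
  let ?f = "\<lambda>p. trace_moment a p J"
  have "(\<Sum>j\<in>-J. trace_exp a n (insert j J)) = (\<Sum>p\<le>n. (\<Sum>j\<in>-J. trace_moment a p (insert j J)) / fact p)"
    unfolding trace_exp_def by (subst sum.swap) (simp add: sum_divide_distrib)
  also have "\<dots> \<le> (\<Sum>p\<le>n. (real (card (-J)) * ?f p + s * (\<Sum>k<p. real (p choose k) * ?f k)) / fact p)"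
    by (intro sum_mono divide_right_mono sum_trace_moment_insert_le[OF unit fr s1]) simp
  also have "\<dots> = real (card (-J)) * trace_exp a n J +
      s * (\<Sum>p\<le>n. \<Sum>k<p. real (p choose k) * ?f k / fact p)"
    by (simp add: trace_exp_def sum.distrib add_divide_distrib sum_distrib_left sum_divide_distrib)
  also have "(\<Sum>p\<le>n. \<Sum>k<p. real (p choose k) * ?f k / fact p)
      = (\<Sum>p\<le>n. \<Sum>k<p. ?f k / fact k * (1 / fact (p - k)))"
    by (intro sum.cong refl) (simp add: binomial_fact)
  also have "\<dots> = (\<Sum>(k, p)\<in>{(k, p). p \<le> n \<and> k < p}. ?f k / fact k * (1 / fact (p - k)))"
    by (subst sum.Sigma) (auto intro!: sum.reindex_bij_witness[of _ "\<lambda>(k, p). (p, k)" "\<lambda>(p, k). (k, p)"])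
  also have "\<dots> = (\<Sum>k\<le>n. \<Sum>r=1..n - k. ?f k / fact k * (1 / fact r))"
    by (subst sum.Sigma)
      (auto intro!: sum.reindex_bij_witness[of _ "\<lambda>(k, r). (k, k + r)" "\<lambda>(k, p). (k, p - k)"])
  also have "\<dots> \<le> (\<Sum>k\<le>n. ?f k / fact k * (exp 1 - 1))"
    unfolding sum_distrib_left[symmetric]
    by (intro sum_mono mult_left_mono sum_inverse_fact_le) (simp add: trace_moment_nonneg)
  also have "\<dots> = (exp 1 - 1) * trace_exp a n J"
    by (simp add: trace_exp_def sum_distrib_left mult.commute)
  finally show ?thesis using s1 by (simp add: algebra_simps mult_left_mono)
qed

text \<open>Normalizing a vector that violates the frame bound gives a Rayleigh quotient of at least
  \<open>t\<close>, hence moments and traces of at least t^p.\<close>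

lemma trace_exp_ge:
  fixes a :: "'m::finite \<Rightarrow> 'a::euclidean_space"
  assumes t: "0 \<le> t" and x: "t * (norm x)\<^sup>2 < (\<Sum>j\<in>J. (a j \<bullet> x)\<^sup>2)"
  shows "(\<Sum>p\<le>n. t ^ p / fact p) \<le> trace_exp a n J"
proof -
  interpret psd_operator "frame_op a J" by (rule psd_operator_frame_op)
  have x0: "x \<noteq> 0" using x by auto
  define y where "y = x /\<^sub>R norm x"
  have y: "norm y = 1" using x0 by (simp add: y_def)
  have "y \<bullet> frame_op a J y = (\<Sum>j\<in>J. (a j \<bullet> x)\<^sup>2) / (norm x)\<^sup>2"
    unfolding inner_frame_op y_def
    by (simp add: sum_distrib_left power2_eq_square divide_inverse algebra_simps)
  also have "\<dots> \<ge> t" using x x0 by (simp add: pos_le_divide_eq)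
  finally have ty: "t \<le> y \<bullet> frame_op a J y" .
  have "t ^ p \<le> trace_moment a p J" for p
  proof (cases "p = 0")
    case True
    have "1 \<le> CARD('m)" by (simp add: Suc_leI)
    then show ?thesis using True by (simp add: trace_moment_def)
  next
    case False
    have "t ^ p \<le> (y \<bullet> frame_op a J y) ^ p" using ty t by (rule power_mono)
    also have "\<dots> \<le> y \<bullet> (frame_op a J ^^ p) y" by (rule moment_ge_power[OF y])
    also have "\<dots> \<le> op_trace (frame_op a J ^^ p)" by (rule moment_le_op_trace_frame_op[OF y])
    finally show ?thesis using False by (simp add: trace_moment_def)
  qed
  then show ?thesis unfolding trace_exp_def by (intro sum_mono divide_right_mono) auto
qed

section \<open>Averages over row orderings\<close>

lemma finite_row_orderings: "finite (row_orderings :: (nat \<Rightarrow> 'm::finite) set)"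
  by (rule finite_subset[OF _ finite_PiE[of "{1..CARD('m)}" "\<lambda>_. UNIV"]])
    (auto simp: row_orderings_def)

lemma row_orderings_nonempty: "(row_orderings :: (nat \<Rightarrow> 'm::finite) set) \<noteq> {}"
proof -
  obtain f :: "nat \<Rightarrow> 'm" where "bij_betw f {1..CARD('m)} UNIV"
    using finite_same_card_bij[of "{1..CARD('m)}" "UNIV :: 'm set"] by auto
  then have "bij_betw (restrict f {1..CARD('m)}) {1..CARD('m)} UNIV"
    by (rule bij_betw_cong[THEN iffD1, rotated]) simp
  then have "restrict f {1..CARD('m)} \<in> row_orderings" by (simp add: row_orderings_def)
  then show ?thesis by blast
qed

text \<open>Exchangeability: swapping the positions \<open>q\<close> and \<open>q'\<close> is an
  involution of the orderings that leaves \<open>B\<close> alone.\<close>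

lemma sum_row_orderings_swap:
  fixes F :: "'m::finite set \<Rightarrow> real"
  assumes q: "q \<in> {1..CARD('m)} - B" and q': "q' \<in> {1..CARD('m)} - B"
  shows "(\<Sum>\<kappa>\<in>row_orderings. F (insert (\<kappa> q) (\<kappa> ` B))) = (\<Sum>\<kappa>\<in>row_orderings. F (insert (\<kappa> q') (\<kappa> ` B)))"
proof (rule sum.reindex_bij_witness[of _ "\<lambda>\<kappa>. \<kappa> \<circ> Transposition.transpose q q'" "\<lambda>\<kappa>. \<kappa> \<circ> Transposition.transpose q q'"])
  fix \<kappa> :: "nat \<Rightarrow> 'm" assume \<kappa>: "\<kappa> \<in> row_orderings"
  let ?t = "Transposition.transpose q q'"
  have t: "bij_betw ?t {1..CARD('m)} {1..CARD('m)}"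
    using q q' by (intro bij_betw_byWitness[of _ ?t]) (auto simp: Transposition.transpose_def)
  have B: "?t ` B = B"
    using q q' by (force simp: Transposition.transpose_def image_iff)
  have "\<kappa> \<circ> ?t \<in> extensional {1..CARD('m)}"
    using \<kappa> q q' by (auto simp: row_orderings_def PiE_def extensional_def Transposition.transpose_def)
  moreover have "bij_betw (\<kappa> \<circ> ?t) {1..CARD('m)} UNIV"
    using \<kappa> t by (auto simp: row_orderings_def intro: bij_betw_trans)
  ultimately show "\<kappa> \<circ> ?t \<in> row_orderings" by (simp add: row_orderings_def PiE_def)
  then show "\<kappa> \<circ> ?t \<in> row_orderings" .
  show "(\<kappa> \<circ> ?t) \<circ> ?t = \<kappa>" by (simp add: o_assoc[symmetric])
  then show "(\<kappa> \<circ> ?t) \<circ> ?t = \<kappa>" .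
  show "F (insert ((\<kappa> \<circ> ?t) q') ((\<kappa> \<circ> ?t) ` B)) = F (insert (\<kappa> q) (\<kappa> ` B))"
    by (metis B comp_apply image_comp transpose_apply_second)
qed

text \<open>Given the rows at the positions \<open>B\<close>, the row at a further position is
  uniform over the remaining rows. By exchangeability one may average over all positions outside
  \<open>B\<close>, and an ordering maps these bijectively onto the rows outside its image of
  \<open>B\<close>.\<close>

lemma sum_row_orderings_insert_le:
  fixes F :: "'m::finite set \<Rightarrow> real"
  assumes step: "\<And>J. (\<Sum>j\<in>-J. F (insert j J)) \<le> (real (card (-J)) + c) * F J"
    and B: "B \<subseteq> {1..CARD('m)}" and q: "q \<in> {1..CARD('m)} - B"
  shows "(\<Sum>\<kappa>\<in>row_orderings. F (\<kappa> ` insert q B)) \<le>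
    (1 + c / real (CARD('m) - card B)) * (\<Sum>\<kappa>\<in>row_orderings. F (\<kappa> ` B))"
proof -
  let ?m = "CARD('m)" and ?R = "row_orderings :: (nat \<Rightarrow> 'm) set"
  have fB: "finite B" using B finite_subset by blast
  have cd: "card ({1..?m} - B) = ?m - card B" using B fB by (simp add: card_Diff_subset)
  have pos: "0 < ?m - card B" unfolding cd[symmetric] using q by (auto simp: card_gt_0_iff)
  have "real (?m - card B) * (\<Sum>\<kappa>\<in>?R. F (\<kappa> ` insert q B)) =
      (\<Sum>q'\<in>{1..?m} - B. \<Sum>\<kappa>\<in>?R. F (insert (\<kappa> q) (\<kappa> ` B)))"
    by (simp add: cd del: One_nat_def)
  also have "\<dots> = (\<Sum>q'\<in>{1..?m} - B. \<Sum>\<kappa>\<in>?R. F (insert (\<kappa> q') (\<kappa> ` B)))"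
    by (intro sum.cong refl sum_row_orderings_swap q)
  also have "\<dots> = (\<Sum>\<kappa>\<in>?R. \<Sum>q'\<in>{1..?m} - B. F (insert (\<kappa> q') (\<kappa> ` B)))"
    by (rule sum.swap)
  also have "\<dots> \<le> (\<Sum>\<kappa>\<in>?R. (real (?m - card B) + c) * F (\<kappa> ` B))"
  proof (intro sum_mono)
    fix \<kappa> :: "nat \<Rightarrow> 'm" assume "\<kappa> \<in> ?R"
    then have bij: "bij_betw \<kappa> {1..?m} UNIV" by (simp add: row_orderings_def)
    have bd: "bij_betw \<kappa> ({1..?m} - B) (- (\<kappa> ` B))"
    proof -
      have inj: "inj_on \<kappa> {1..?m}" and im: "\<kappa> ` {1..?m} = UNIV"
        using bij by (simp_all add: bij_betw_def)
      have "\<kappa> ` ({1..?m} - B) = - (\<kappa> ` B)"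
        using inj_on_image_set_diff[OF inj _ B, of "{1..?m}"] unfolding im Compl_eq_Diff_UNIV by auto
      then show ?thesis using inj_on_subset[OF inj] by (auto simp: bij_betw_def)
    qed
    have "(\<Sum>q'\<in>{1..?m} - B. F (insert (\<kappa> q') (\<kappa> ` B))) = (\<Sum>j\<in>- (\<kappa> ` B). F (insert j (\<kappa> ` B)))"
      by (rule sum.reindex_bij_betw[OF bd])
    also have "\<dots> \<le> (real (card (- (\<kappa> ` B))) + c) * F (\<kappa> ` B)" by (rule step)
    also have "card (- (\<kappa> ` B)) = ?m - card B" using bij_betw_same_card[OF bd] cd by simp
    finally show "(\<Sum>q'\<in>{1..?m} - B. F (insert (\<kappa> q') (\<kappa> ` B))) \<le> (real (?m - card B) + c) * F (\<kappa> ` B)" .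
  qed
  also have "\<dots> = (real (?m - card B) + c) * (\<Sum>\<kappa>\<in>?R. F (\<kappa> ` B))"
    by (simp only: sum_distrib_left)
  finally have "(\<Sum>\<kappa>\<in>?R. F (\<kappa> ` insert q B)) \<le>
      (real (?m - card B) + c) * (\<Sum>\<kappa>\<in>?R. F (\<kappa> ` B)) / real (?m - card B)"
    using pos by (simp add: pos_le_divide_eq mult.commute)
  then show ?thesis using pos by (simp add: add_divide_distrib distrib_right)
qed

text \<open>The block is filled one position at a time. Drawing without replacement divides by the
  number of remaining rows; \<open>half\<close> keeps it at least m / 2, whence the factor 2 in the
  exponent.\<close>

lemma sum_row_orderings_trace_exp_le:
  fixes a :: "'m::finite \<Rightarrow> 'a::euclidean_space"
  assumes unit: "\<And>j. norm (a j) = 1"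
    and fr: "\<And>x. (\<Sum>j\<in>UNIV. (a j \<bullet> x)\<^sup>2) \<le> s * (norm x)\<^sup>2" and s1: "1 \<le> s"
    and B: "B \<subseteq> {1..CARD('m)}" and half: "2 * card B \<le> CARD('m)"
  shows "(\<Sum>\<kappa>\<in>row_orderings. trace_exp a n (\<kappa> ` B)) \<le>
    exp (2 * s * (exp 1 - 1) / real CARD('m) * real (card B)) *
      (real CARD('m) * real (card (row_orderings :: (nat \<Rightarrow> 'm) set)))"
proof -
  let ?m = "CARD('m)" and ?R = "row_orderings :: (nat \<Rightarrow> 'm) set"
  let ?c = "s * (exp 1 - 1)" and ?d = "2 * s * (exp 1 - 1) / real CARD('m)"
  have fB: "finite B" using B finite_subset by blast
  have c0: "0 \<le> ?c" using s1 by simp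
  show ?thesis using fB B half
  proof (induction B rule: finite_induct)
    case empty
    then show ?case by (simp add: trace_exp_empty)
  next
    case (insert q B)
    let ?G = "\<lambda>B. \<Sum>\<kappa>\<in>?R. trace_exp a n (\<kappa> ` B)"
    have le: "2 * card B \<le> ?m" "2 * card B + 2 \<le> ?m" using insert by auto
    have "?G (insert q B) \<le> (1 + ?c / real (?m - card B)) * ?G B"
      using insert by (intro sum_row_orderings_insert_le sum_trace_exp_insert_le unit fr s1) auto
    also have "\<dots> \<le> exp ?d * ?G B"
    proof (intro mult_right_mono sum_nonneg trace_exp_nonneg)
      have "?c / real (?m - card B) \<le> ?c / (real ?m / 2)"
        using c0 le by (intro divide_left_mono) (auto simp: of_nat_diff)
      also have "\<dots> = ?d" by simp
      finally show "1 + ?c / real (?m - card B) \<le> exp ?d"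
        by (intro order_trans[OF add_left_mono exp_ge_add_one_self])
    qed
    also have "\<dots> \<le> exp ?d * (exp (?d * real (card B)) * (real ?m * real (card ?R)))"
      using insert le by (intro mult_left_mono) auto
    also have "\<dots> = exp (?d * real (card (insert q B))) * (real ?m * real (card ?R))"
      using insert by (simp add: exp_add[symmetric] distrib_left add.commute flip: mult.assoc)
    finally show ?case .
  qed
qed

text \<open>For the rows of a matrix this bounds the squared largest singular value of A_J by
  \<open>t\<close>, expressed by the quadratic form so that no submatrix has to be formed.\<close>

definition frame_bound :: "('m \<Rightarrow> 'a::real_inner) \<Rightarrow> 'm set \<Rightarrow> real \<Rightarrow> bool" where
  "frame_bound a J t \<longleftrightarrow> (\<forall>x. (\<Sum>j\<in>J. (a j \<bullet> x)\<^sup>2) \<le> t * (norm x)\<^sup>2)"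

text \<open>Markov's inequality at every truncation order; only the scalar series is sent to its
  limit. By \<open>sB\<close> the exponent collected over a block is at most 2 (e - 1).\<close>

lemma card_bad_row_orderings_le:
  fixes a :: "'m::finite \<Rightarrow> 'a::euclidean_space"
  assumes unit: "\<And>j. norm (a j) = 1"
    and fr: "\<And>x. (\<Sum>j\<in>UNIV. (a j \<bullet> x)\<^sup>2) \<le> s * (norm x)\<^sup>2" and s1: "1 \<le> s"
    and B: "B \<subseteq> {1..CARD('m)}" and half: "2 * card B \<le> CARD('m)"
    and sB: "s * real (card B) \<le> real CARD('m)" and t: "0 \<le> t"
  shows "real (card {\<kappa> \<in> row_orderings. \<not> frame_bound a (\<kappa> ` B) t}) * exp t \<le>
    exp (2 * (exp 1 - 1)) * (real CARD('m) * real (card (row_orderings :: (nat \<Rightarrow> 'm) set)))"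
proof -
  let ?m = "CARD('m)" and ?R = "row_orderings :: (nat \<Rightarrow> 'm) set"
  let ?bad = "{\<kappa> \<in> ?R. \<not> frame_bound a (\<kappa> ` B) t}"
  let ?K = "exp (2 * (exp 1 - 1)) * (real ?m * real (card ?R))"
  have "real (card ?bad) * (\<Sum>p\<le>n. t ^ p / fact p) \<le> ?K" for n
  proof -
    have "real (card ?bad) * (\<Sum>p\<le>n. t ^ p / fact p) = (\<Sum>\<kappa>\<in>?bad. \<Sum>p\<le>n. t ^ p / fact p)" by simp
    also have "\<dots> \<le> (\<Sum>\<kappa>\<in>?bad. trace_exp a n (\<kappa> ` B))"
      by (intro sum_mono) (auto simp: frame_bound_def not_le intro: trace_exp_ge[OF t])
    also have "\<dots> \<le> (\<Sum>\<kappa>\<in>?R. trace_exp a n (\<kappa> ` B))"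
      by (intro sum_mono2) (auto simp: finite_row_orderings trace_exp_nonneg)
    also have "\<dots> \<le> exp (2 * s * (exp 1 - 1) / real ?m * real (card B)) * (real ?m * real (card ?R))"
      by (rule sum_row_orderings_trace_exp_le[OF unit fr s1 B half])
    also have "\<dots> \<le> ?K"
    proof (intro mult_right_mono)
      have "2 * s * (exp 1 - 1) / real ?m * real (card B) = 2 * (exp 1 - 1) * (s * real (card B) / real ?m)"
        by simp
      also have "\<dots> \<le> 2 * (exp 1 - 1) * 1"
        using sB by (intro mult_left_mono) auto
      finally show "exp (2 * s * (exp 1 - 1) / real ?m * real (card B)) \<le> exp (2 * (exp 1 - 1))" by simp
    qed simp
    finally show ?thesis .
  qed
  moreover have "(\<lambda>n. real (card ?bad) * (\<Sum>p\<le>n. t ^ p / fact p)) \<longlonglongrightarrow> real (card ?bad) * exp t"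
    using exp_converges[of t] by (intro tendsto_mult tendsto_const) (simp add: sums_def_le divide_inverse mult.commute)
  ultimately show ?thesis by (intro LIMSEQ_le_const2) auto
qed

section \<open>The largest singular value and random blocks\<close>

lemma inner_gram: "x \<bullet> ((transpose A ** A) *v y) = (A *v x) \<bullet> (A *v (y :: real^'n))"
proof -
  have "(transpose A ** A) *v y = (A *v y) v* A"
    by (simp add: matrix_vector_mul_assoc[symmetric] transpose_matrix_vector)
  then show ?thesis by (metis dot_lmul_matrix inner_commute)
qed

text \<open>\<open>Max\<close> in \<open>sigma_max\<close> is meaningful only on a finite set.
  Distinct nonnegative \<open>s\<close> belong to distinct eigenvalues s^2, whose eigenvectors are
  orthogonal and thus finite in number.\<close>

lemma finite_singular_values: "finite (singular_values (A :: real^'n^'m))"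
proof -
  let ?M = "transpose A ** A"
  have "\<forall>s\<in>singular_values A. \<exists>v. v \<noteq> 0 \<and> ?M *v v = s\<^sup>2 *\<^sub>R v"
    by (simp add: singular_values_def)
  then obtain v where v: "\<And>s. s \<in> singular_values A \<Longrightarrow> v s \<noteq> 0 \<and> ?M *v v s = s\<^sup>2 *\<^sub>R v s"
    by metis
  have orth: "v s \<bullet> v t = 0" if s: "s \<in> singular_values A" and t: "t \<in> singular_values A" and "s \<noteq> t" for s t
  proof -
    have "v s \<bullet> (?M *v v t) = v t \<bullet> (?M *v v s)"
      unfolding inner_gram by (rule inner_commute)
    then have "(t\<^sup>2 - s\<^sup>2) * (v s \<bullet> v t) = 0"
      using v[OF s] v[OF t] by (simp add: left_diff_distrib inner_commute)
    moreover have "s\<^sup>2 \<noteq> t\<^sup>2"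
      using s t \<open>s \<noteq> t\<close> by (auto simp: singular_values_def power2_eq_iff)
    ultimately show ?thesis by simp
  qed
  have inj: "inj_on v (singular_values A)"
  proof (rule inj_onI, rule ccontr)
    fix s t assume st: "s \<in> singular_values A" "t \<in> singular_values A" "v s = v t" "s \<noteq> t"
    then have "v s \<bullet> v s = 0" using orth[of s t] by simp
    then show False using v[OF st(1)] by simp
  qed
  have "pairwise orthogonal (v ` singular_values A)"
    unfolding pairwise_def orthogonal_def using orth by auto
  then have "independent (v ` singular_values A)"
    by (rule pairwise_orthogonal_independent) (use v in auto)
  then have "finite (v ` singular_values A)" by (rule independent_imp_finite)
  then show ?thesis using inj by (rule finite_imageD)
qed

text \<open>A maximizer \<open>v\<close> of the Rayleigh quotient, with value \<open>\<mu>\<close>, is an eigenvector: it lies in the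
  kernel of the quadratic form of \<open>\<mu> - A\<^sup>T A\<close>, which is positive semidefinite.\<close>

lemma norm_matrix_vector_le_sigma_max:
  fixes A :: "real^'n^'m"
  shows "(norm (A *v x))\<^sup>2 \<le> (sigma_max A)\<^sup>2 * (norm x)\<^sup>2"
proof -
  let ?M = "transpose A ** A"
  have "compact (sphere (0::real^'n) 1)" by simp
  moreover have "axis undefined 1 \<in> sphere (0::real^'n) 1" by simp
  moreover have "continuous_on (sphere 0 1) (\<lambda>x. norm (A *v x))"
    by (intro continuous_intros linear_continuous_on) (simp add: linear_linear)
  ultimately obtain v where v: "norm v = 1" and mx: "\<And>y. norm y = 1 \<Longrightarrow> norm (A *v y) \<le> norm (A *v v)"
    using continuous_attains_sup[of "sphere (0::real^'n) 1" "\<lambda>x. norm (A *v x)"] by auto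
  define s where "s = norm (A *v v)"
  have le: "(norm (A *v y))\<^sup>2 \<le> s\<^sup>2 * (norm y)\<^sup>2" for y
  proof (cases "y = 0")
    case False
    have "norm (A *v (y /\<^sub>R norm y)) \<le> s" unfolding s_def using False by (intro mx) simp
    then have "norm (A *v y) \<le> s * norm y"
      using False by (simp add: matrix_vector_mult_scaleR divide_simps mult.commute)
    then show ?thesis by (metis norm_ge_zero power_mono power_mult_distrib)
  qed simp
  define S where "S y = s\<^sup>2 *\<^sub>R y - ?M *v y" for y
  have S: "x \<bullet> S y = s\<^sup>2 * (x \<bullet> y) - (A *v x) \<bullet> (A *v y)" for x y
    by (simp add: S_def inner_diff_right inner_gram)
  have "(y \<bullet> S v)\<^sup>2 \<le> (y \<bullet> S y) * (v \<bullet> S v)" for y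
  proof (rule psd_Cauchy_Schwarz)
    show "linear S"
      by (rule linearI) (simp_all add: S_def matrix_vector_right_distrib scaleR_add_right
          scaleR_diff_right matrix_vector_mult_scaleR mult.commute)
    show "x \<bullet> S y = S x \<bullet> y" for x y
      unfolding inner_commute[of "S x" y] S inner_commute[of y x] inner_commute[of "A *v y"] by simp
    show "0 \<le> y \<bullet> S y" for y
      unfolding S using le[of y] by (simp add: power2_norm_eq_inner)
  qed
  moreover have "v \<bullet> S v = 0"
    unfolding S using v by (simp add: s_def dot_square_norm)
  ultimately have "(S v \<bullet> S v)\<^sup>2 \<le> 0" by (metis mult_zero_right)
  then have "S v = 0" by simp
  then have "?M *v v = s\<^sup>2 *\<^sub>R v" by (simp add: S_def)
  moreover have "v \<noteq> 0" using v by auto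
  ultimately have "s \<in> singular_values A" unfolding singular_values_def by (auto simp: s_def)
  then have "s \<le> sigma_max A" unfolding sigma_max_def by (rule Max_ge[OF finite_singular_values])
  then have "s\<^sup>2 \<le> (sigma_max A)\<^sup>2" by (intro power_mono) (simp_all add: s_def)
  then have "s\<^sup>2 * (norm x)\<^sup>2 \<le> (sigma_max A)\<^sup>2 * (norm x)\<^sup>2" by (intro mult_right_mono) auto
  then show ?thesis using le[of x] by linarith
qed

lemma matrix_vector_component_row: "(A *v x) $ j = row j A \<bullet> (x :: real^'n)"
  by (simp add: matrix_vector_mult_def row_def inner_vec_def)

lemma frame_bound_sigma_max:
  fixes A :: "real^'n^'m"
  shows "(\<Sum>j\<in>UNIV. (row j A \<bullet> x)\<^sup>2) \<le> (sigma_max A)\<^sup>2 * (norm x)\<^sup>2"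
proof -
  have "(\<Sum>j\<in>UNIV. (row j A \<bullet> x)\<^sup>2) = (norm (A *v x))\<^sup>2"
    unfolding power2_norm_eq_inner inner_vec_def[of "A *v x"]
    by (simp add: matrix_vector_component_row power2_eq_square)
  then show ?thesis using norm_matrix_vector_le_sigma_max by simp
qed

lemma sigma_max_ge_1:
  fixes A :: "real^'n^'m"
  assumes "\<And>i. norm (row i A) = 1"
  shows "1 \<le> (sigma_max A)\<^sup>2"
proof -
  fix i :: 'm
  have "1 = (row i A \<bullet> row i A)\<^sup>2" using assms by (simp add: dot_square_norm)
  also have "\<dots> \<le> (\<Sum>j\<in>UNIV. (row j A \<bullet> row i A)\<^sup>2)"
    by (rule member_le_sum) auto
  also have "\<dots> \<le> (sigma_max A)\<^sup>2" using frame_bound_sigma_max[of A "row i A"] assms by simp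
  finally show ?thesis .
qed

lemma frame_bound_card:
  assumes "\<And>j. norm (a j) = 1" "finite J" "real (card J) \<le> t"
  shows "frame_bound a J t"
  unfolding frame_bound_def
proof
  fix x
  have "(a j \<bullet> x)\<^sup>2 \<le> (norm x)\<^sup>2" for j
    using Cauchy_Schwarz_ineq2[of "a j" x] assms(1) by (simp add: abs_le_square_iff[symmetric])
  then have "(\<Sum>j\<in>J. (a j \<bullet> x)\<^sup>2) \<le> real (card J) * (norm x)\<^sup>2"
    by (metis (no_types, lifting) sum_bounded_above)
  also have "\<dots> \<le> t * (norm x)\<^sup>2" using assms(3) by (intro mult_right_mono) auto
  finally show "(\<Sum>j\<in>J. (a j \<bullet> x)\<^sup>2) \<le> t * (norm x)\<^sup>2" .
qed

lemma frame_bound_mono: "frame_bound a J t \<Longrightarrow> t \<le> u \<Longrightarrow> frame_bound a J u"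
  unfolding frame_bound_def by (meson mult_right_mono order_trans zero_le_power2)

text \<open>The bound is smaller than \<open>6 ln (1 + m)\<close> by the factor \<open>\<tau> s / m\<close>, which compensates the loss
  in rounding \<open>m / s\<close> down to \<open>\<tau>\<close>. This costs little: for \<open>\<tau> \<le> 5\<close> blocks trivially satisfy the
  bound \<open>\<tau>\<close>, and for larger \<open>\<tau>\<close> the factor is at least \<open>5/6\<close>.\<close>

lemma prob_blocks_frame_bound:
  fixes a :: "'m::finite \<Rightarrow> 'a::euclidean_space"
  assumes unit: "\<And>j. norm (a j) = 1"
    and fr: "\<And>x. (\<Sum>j\<in>UNIV. (a j \<bullet> x)\<^sup>2) \<le> s * (norm x)\<^sup>2" and s1: "1 \<le> s"
    and \<tau>: "\<tau> = nat \<lfloor>real CARD('m) / s\<rfloor>" and l0: "0 < l" and lt: "l * \<tau> = CARD('m)"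
  shows "measure_pmf.prob (pmf_of_set (row_orderings :: (nat \<Rightarrow> 'm) set))
    {\<kappa> \<in> row_orderings. \<forall>i\<in>{1..l}. frame_bound a (block \<kappa> \<tau> i)
      (6 * ln (1 + real CARD('m)) * (real \<tau> * s / real CARD('m)))} \<ge> 1 - 1 / real CARD('m)"
    (is "measure_pmf.prob (pmf_of_set ?R) ?good \<ge> _")
proof -
  let ?m = "CARD('m)"
  let ?L = "6 * ln (1 + real ?m) * (real \<tau> * s / real ?m)"
  have m0: "0 < ?m" by simp
  have \<tau>0: "0 < \<tau>" using lt m0 by (metis gr0I mult_is_0 less_numeral_extra(3))
  have fl: "real \<tau> = of_int \<lfloor>real ?m / s\<rfloor>" using \<tau> s1 by simp
  have up: "real \<tau> * s \<le> real ?m"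
  proof -
    have "real \<tau> \<le> real ?m / s" unfolding fl by (rule of_int_floor_le)
    then show ?thesis using s1 by (simp add: pos_le_divide_eq)
  qed
  have low: "real ?m < (real \<tau> + 1) * s"
  proof -
    have "real ?m / s < real \<tau> + 1" unfolding fl by (rule real_of_int_floor_add_one_gt)
    then show ?thesis using s1 by (simp add: pos_divide_less_eq)
  qed
  have prob: "measure_pmf.prob (pmf_of_set ?R) ?good = real (card ?good) / real (card ?R)"
    by (subst measure_pmf_of_set) (auto simp: finite_row_orderings row_orderings_nonempty Int_absorb1)
  have R0: "0 < real (card ?R)"
    using finite_row_orderings row_orderings_nonempty by (simp add: card_gt_0_iff)
  have bsub: "{(i - 1) * \<tau> + 1..i * \<tau>} \<subseteq> {1..?m}" if "i \<in> {1..l}" for i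
    using that lt mult_le_mono1[of i l \<tau>] by auto
  have bcard: "card {(i - 1) * \<tau> + 1..i * \<tau>} = \<tau>" if "i \<in> {1..l}" for i
    using that by (cases i) auto
  have all_good: ?thesis
    if "\<And>\<kappa> i. \<kappa> \<in> ?R \<Longrightarrow> i \<in> {1..l} \<Longrightarrow> frame_bound a (block \<kappa> \<tau> i) ?L"
  proof -
    have "?good = ?R" using that by auto
    then show ?thesis unfolding prob using R0 by simp
  qed
  \<comment> \<open>A single block violates 2 \<tau> <= m, on which the random argument rests; there
    \<tau> = m, and the frame bound \<open>s\<close> of all rows suffices.\<close>
  consider "l = 1" | "2 \<le> l" "\<tau> \<le> 5" | "2 \<le> l" "5 < \<tau>" using l0 by linarith
  then show ?thesis
  proof cases
    case 1
    have "2 / 3 \<le> ln (2::real)" by (rule ln2_ge_two_thirds)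
    also have "\<dots> \<le> ln (1 + real ?m)" using m0 by (subst ln_le_cancel_iff) auto
    finally have "1 * s \<le> 6 * ln (1 + real ?m) * s" using s1 by (intro mult_right_mono) auto
    also have "\<dots> = ?L" using 1 lt m0 by simp
    finally have "s \<le> ?L" by simp
    moreover have "frame_bound a J s" for J
      unfolding frame_bound_def
    proof
      fix x
      have "(\<Sum>j\<in>J. (a j \<bullet> x)\<^sup>2) \<le> (\<Sum>j\<in>UNIV. (a j \<bullet> x)\<^sup>2)" by (intro sum_mono2) auto
      then show "(\<Sum>j\<in>J. (a j \<bullet> x)\<^sup>2) \<le> s * (norm x)\<^sup>2" using fr[of x] by linarith
    qed
    ultimately show ?thesis by (intro all_good) (rule frame_bound_mono)
  next
    case 2
    have m2: "2 \<le> ?m" using 2 \<tau>0 lt by (metis mult_le_mono mult.right_neutral Suc_leI One_nat_def)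
    \<comment> \<open>Two nonempty blocks give 1 + m >= 3 >= e, so 6 ln (1 + m) >= 6 >= \<tau> +
      1.\<close>
    have "1 \<le> ln (1 + real ?m)"
      using m2 exp_le by (subst ln_ge_iff) auto
    then have "real \<tau> + 1 \<le> 6 * ln (1 + real ?m)" using 2 by linarith
    then have "(real \<tau> + 1) * s \<le> 6 * ln (1 + real ?m) * s" using s1 by (intro mult_right_mono) auto
    then have "real ?m \<le> 6 * ln (1 + real ?m) * s" using low by linarith
    then have "real \<tau> * (real ?m / real ?m) \<le> real \<tau> * (6 * ln (1 + real ?m) * s / real ?m)"
      by (intro mult_left_mono divide_right_mono) auto
    then have \<tau>L: "real \<tau> \<le> ?L" using m0 by (simp add: mult_ac)
    show ?thesis
    proof (rule all_good, rule frame_bound_card[OF unit])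
      fix \<kappa> :: "nat \<Rightarrow> 'm" and i assume i: "i \<in> {1..l}"
      have "card (block \<kappa> \<tau> i) \<le> \<tau>"
        unfolding block_def using card_image_le[of "{(i - 1) * \<tau> + 1..i * \<tau>}" \<kappa>] bcard[OF i] by simp
      then show "real (card (block \<kappa> \<tau> i)) \<le> ?L" using \<tau>L by linarith
    qed simp
  next
    case 3
    \<comment> \<open>The exponent 5 pays for m^2 from exp (2 (e - 1)), m from the constant term of
      the trace, m from the number of blocks, and m for the failure probability. It fits below 6
      because \<tau> s / m > \<tau> / (\<tau> + 1) >= 5/6.\<close>
    let ?t = "5 * ln (1 + real ?m)"
    let ?bad = "\<lambda>i. {\<kappa> \<in> ?R. \<not> frame_bound a (block \<kappa> \<tau> i) ?t}"
    have half: "2 * \<tau> \<le> ?m" using 3 lt by (metis mult_le_mono1)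
    then have m10: "10 \<le> ?m" using 3 by simp
    have ln0: "0 \<le> ln (1 + real ?m)" by simp
    have tL: "?t \<le> ?L"
    proof -
      have "(real \<tau> + 1) * s * 5 \<le> 6 * real \<tau> * s" using 3 s1 by (simp add: algebra_simps)
      then have "5 \<le> 6 * (real \<tau> * s / real ?m)" using low m0 by (simp add: field_simps)
      then have "5 * ln (1 + real ?m) \<le> 6 * (real \<tau> * s / real ?m) * ln (1 + real ?m)"
        by (intro mult_right_mono ln0)
      then show ?thesis by (simp add: mult_ac)
    qed
    \<comment> \<open>The constant is at most 3^4 = 81, and m >= 10 makes this less than
      m^2.\<close>
    have "2 * (exp 1 - 1) \<le> (4::real)" using exp_le by simp
    then have "exp (2 * (exp 1 - 1)) \<le> exp (4::real)" by simp
    also have "exp (4::real) = exp 1 ^ 4" by (simp add: exp_of_nat_mult[symmetric])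
    also have "\<dots> \<le> (3::real) ^ 4" using exp_le by (intro power_mono) auto
    also have "\<dots> \<le> (10::real)\<^sup>2" by simp
    also have "\<dots> \<le> (real ?m)\<^sup>2" using m10 by (intro power_mono) auto
    finally have K: "exp (2 * (exp 1 - 1)) \<le> (real ?m)\<^sup>2" .
    have bad: "real (card (?bad i)) * real ?m ^ 5 \<le> real ?m ^ 3 * real (card ?R)" if i: "i \<in> {1..l}" for i
    proof -
      have "real ?m ^ 5 \<le> (1 + real ?m) ^ 5" by (intro power_mono) auto
      also have "\<dots> = exp ?t" by (simp add: exp_of_nat_mult[of 5, simplified])
      finally have "real (card (?bad i)) * real ?m ^ 5 \<le> real (card (?bad i)) * exp ?t"
        by (intro mult_left_mono) auto
      also have "\<dots> \<le> exp (2 * (exp 1 - 1)) * (real ?m * real (card ?R))"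
        unfolding block_def
        by (rule card_bad_row_orderings_le[OF unit fr s1 bsub[OF i]])
          (use bcard[OF i] half up ln0 in \<open>simp_all add: mult.commute\<close>)
      also have "\<dots> \<le> (real ?m)\<^sup>2 * (real ?m * real (card ?R))" by (intro mult_right_mono K) simp
      finally show ?thesis by (simp add: power2_eq_square power3_eq_cube)
    qed
    have fin: "finite (\<Union>i\<in>{1..l}. ?bad i)" using finite_row_orderings by auto
    have "?R \<subseteq> ?good \<union> (\<Union>i\<in>{1..l}. ?bad i)" using frame_bound_mono[OF _ tL] by blast
    then have "card ?R \<le> card (?good \<union> (\<Union>i\<in>{1..l}. ?bad i))"
      using fin finite_row_orderings by (intro card_mono) auto
    also have "\<dots> \<le> card ?good + card (\<Union>i\<in>{1..l}. ?bad i)" by (rule card_Un_le)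
    also have "card (\<Union>i\<in>{1..l}. ?bad i) \<le> (\<Sum>i=1..l. card (?bad i))" by (rule card_UN_le) simp
    finally have "real (card ?R) \<le> real (card ?good) + (\<Sum>i=1..l. real (card (?bad i)))"
      by (simp flip: of_nat_sum of_nat_add)
    then have "(real (card ?R) - real (card ?good)) * real ?m ^ 5 \<le> (\<Sum>i=1..l. real (card (?bad i)) * real ?m ^ 5)"
      unfolding sum_distrib_right[symmetric] by (intro mult_right_mono) auto
    also have "\<dots> \<le> (\<Sum>i=1..l. real ?m ^ 3 * real (card ?R))" by (intro sum_mono bad)
    also have "\<dots> = real l * (real ?m ^ 3 * real (card ?R))" by simp
    also have "\<dots> \<le> real ?m * (real ?m ^ 3 * real (card ?R))"
    proof (intro mult_right_mono)
      have "l \<le> l * \<tau>" using \<tau>0 by simp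
      then show "real l \<le> real ?m" unfolding lt by simp
    qed simp
    finally have "(real (card ?R) - real (card ?good)) * real ?m * real ?m ^ 4 \<le> real (card ?R) * real ?m ^ 4"
      by (simp add: eval_nat_numeral mult_ac)
    then have "(real (card ?R) - real (card ?good)) * real ?m \<le> real (card ?R)"
      using m0 by (simp add: mult_le_cancel_right)
    then have "real (card ?R) - real (card ?good) \<le> real (card ?R) / real ?m"
      using m0 by (simp add: pos_le_divide_eq)
    then show ?thesis unfolding prob using R0 m0 by (simp add: field_simps)
  qed
qed

section \<open>Bregman distances of the sparse regularizer\<close>

lemma subdifferentialD: "s \<in> subdifferential f x \<Longrightarrow> f x + s \<bullet> (y - x) \<le> f y"
  by (simp add: subdifferential_def)

lemma bregman_nonneg: "s \<in> subdifferential f x \<Longrightarrow> 0 \<le> bregman f s x z"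
  using subdifferentialD[of s f x z] by (simp add: bregman_def)

lemma norm_sq_vec: "(norm (x :: real^'n))\<^sup>2 = (\<Sum>j\<in>UNIV. (x $ j)\<^sup>2)"
  unfolding power2_norm_eq_inner inner_vec_def by (simp add: power2_eq_square)

text \<open>The difference \<open>s - x\<close> is a subgradient of the weighted absolute value at
  \<open>x\<close>: it is lam or -lam beyond the threshold and \<open>s\<close> itself where
  \<open>x = 0\<close>. The quadratic part leaves the slack (y - x)^2 / 2.\<close>

lemma soft_threshold_subgradient_real:
  fixes lam s y :: real
  assumes "0 \<le> lam" and x: "x = max (\<bar>s\<bar> - lam) 0 * sgn s"
  shows "lam * \<bar>x\<bar> + x\<^sup>2 / 2 + s * (y - x) \<le> lam * \<bar>y\<bar> + y\<^sup>2 / 2"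
proof -
  have y: "lam * y \<le> lam * \<bar>y\<bar>" "- (lam * y) \<le> lam * \<bar>y\<bar>" using assms(1)
    by (metis abs_ge_self mult_left_mono, metis abs_ge_minus_self minus_mult_right mult_left_mono)
  have "lam * \<bar>x\<bar> + (s - x) * (y - x) \<le> lam * \<bar>y\<bar>"
  proof -
    consider "lam < s" | "s < - lam" | "\<bar>s\<bar> \<le> lam" by linarith
    then show ?thesis
    proof cases
      case 1
      then have sx: "s - x = lam" "\<bar>x\<bar> = x" using x assms(1) by auto
      show ?thesis unfolding sx using y by (simp add: algebra_simps)
    next
      case 2
      then have sx: "s - x = - lam" "\<bar>x\<bar> = - x" using x assms(1) by auto
      show ?thesis unfolding sx using y by (simp add: algebra_simps)
    next
      case 3
      then have "x = 0" using x by simp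
      moreover have "s * y \<le> \<bar>s\<bar> * \<bar>y\<bar>" by (metis abs_ge_self abs_mult)
      moreover have "\<bar>s\<bar> * \<bar>y\<bar> \<le> lam * \<bar>y\<bar>" using 3 by (intro mult_right_mono) auto
      ultimately show ?thesis by simp
    qed
  qed
  moreover have "0 \<le> (y - x)\<^sup>2" by simp
  ultimately show ?thesis by (simp add: power2_eq_square field_simps)
qed

lemma soft_threshold_subgradient:
  assumes "0 \<le> lam"
  shows "s \<in> subdifferential (sparse_psi lam) (soft_threshold lam (s :: real^'n))"
  unfolding subdifferential_def
proof (intro CollectI allI)
  fix y :: "real^'n"
  let ?x = "soft_threshold lam s"
  have "(\<Sum>j\<in>UNIV. lam * \<bar>?x $ j\<bar> + (?x $ j)\<^sup>2 / 2 + s $ j * (y $ j - ?x $ j))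
      \<le> (\<Sum>j\<in>UNIV. lam * \<bar>y $ j\<bar> + (y $ j)\<^sup>2 / 2)"
    by (intro sum_mono soft_threshold_subgradient_real assms) (simp add: soft_threshold_def)
  then show "sparse_psi lam ?x + s \<bullet> (y - ?x) \<le> sparse_psi lam y"
    by (simp add: sparse_psi_def norm_sq_vec inner_vec_def sum.distrib sum_distrib_left sum_divide_distrib)
qed

lemma sparse_psi_convex_combination:
  fixes x y :: "real^'n"
  assumes "0 \<le> lam" "0 \<le> u" "u \<le> 1"
  shows "sparse_psi lam (x + u *\<^sub>R (y - x)) + u * (1 - u) / 2 * (norm (y - x))\<^sup>2
    \<le> (1 - u) * sparse_psi lam x + u * sparse_psi lam y"
proof -
  have "\<bar>(x + u *\<^sub>R (y - x)) $ j\<bar> \<le> (1 - u) * \<bar>x $ j\<bar> + u * \<bar>y $ j\<bar>" for j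
  proof -
    have "(x + u *\<^sub>R (y - x)) $ j = (1 - u) * x $ j + u * y $ j" by (simp add: algebra_simps)
    also have "\<bar>\<dots>\<bar> \<le> \<bar>(1 - u) * x $ j\<bar> + \<bar>u * y $ j\<bar>" by (rule abs_triangle_ineq)
    finally show ?thesis using assms by (simp add: abs_mult)
  qed
  then have "(\<Sum>j\<in>UNIV. \<bar>(x + u *\<^sub>R (y - x)) $ j\<bar>) \<le> (\<Sum>j\<in>UNIV. (1 - u) * \<bar>x $ j\<bar> + u * \<bar>y $ j\<bar>)"
    by (intro sum_mono)
  then have "lam * (\<Sum>j\<in>UNIV. \<bar>(x + u *\<^sub>R (y - x)) $ j\<bar>)
      \<le> lam * ((1 - u) * (\<Sum>j\<in>UNIV. \<bar>x $ j\<bar>) + u * (\<Sum>j\<in>UNIV. \<bar>y $ j\<bar>))"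
    using assms(1) by (intro mult_left_mono) (simp_all add: sum.distrib sum_distrib_left)
  moreover have "(norm (x + u *\<^sub>R (y - x)))\<^sup>2 + u * (1 - u) * (norm (y - x))\<^sup>2
      = (1 - u) * (norm x)\<^sup>2 + u * (norm y)\<^sup>2"
    unfolding power2_norm_eq_inner
    by (simp add: inner_add_left inner_add_right inner_diff_left inner_diff_right inner_commute algebra_simps)
  ultimately show ?thesis unfolding sparse_psi_def by (simp add: field_simps)
qed

text \<open>The subgradient inequality at an intermediate point, combined with the quadratic gain
  along the segment, gives the claim with a factor \<open>z < 1\<close> on the square; letting
  \<open>z\<close> tend to 1 gives modulus one for every subgradient.\<close>

lemma sparse_psi_strongly_convex:
  fixes x y :: "real^'n"
  assumes lam: "0 \<le> lam" and s: "s \<in> subdifferential (sparse_psi lam) x"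
  shows "sparse_psi lam x + s \<bullet> (y - x) + (norm (y - x))\<^sup>2 / 2 \<le> sparse_psi lam y"
proof -
  have "z * ((norm (y - x))\<^sup>2 / 2) \<le> sparse_psi lam y - sparse_psi lam x - s \<bullet> (y - x)"
    if z: "0 < z" "z < 1" for z
  proof -
    have "sparse_psi lam x + (1 - z) * (s \<bullet> (y - x)) \<le> sparse_psi lam (x + (1 - z) *\<^sub>R (y - x))"
      using subdifferentialD[OF s, of "x + (1 - z) *\<^sub>R (y - x)"] by simp
    then have "(1 - z) * (z * ((norm (y - x))\<^sup>2 / 2))
        \<le> (1 - z) * (sparse_psi lam y - sparse_psi lam x - s \<bullet> (y - x))"
      using sparse_psi_convex_combination[OF lam, of "1 - z" x y] z by (simp add: algebra_simps)
    then show ?thesis using z by (simp add: mult_le_cancel_left)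
  qed
  then have "(norm (y - x))\<^sup>2 / 2 \<le> sparse_psi lam y - sparse_psi lam x - s \<bullet> (y - x)"
    by (rule field_le_mult_one_interval)
  then show ?thesis by simp
qed

text \<open>Strong convexity supplies half the squared length of \<open>x' - x\<close>, which
  absorbs the term t <\<alpha>, x' - x> by completing the square.\<close>

lemma bregman_step_le:
  fixes x x' z s \<alpha> :: "real^'n"
  assumes lam: "0 \<le> lam" and s: "s \<in> subdifferential (sparse_psi lam) x"
  shows "bregman (sparse_psi lam) (s - t *\<^sub>R \<alpha>) x' z
    \<le> bregman (sparse_psi lam) s x z - t * (\<alpha> \<bullet> (x - z)) + t\<^sup>2 / 2 * (norm \<alpha>)\<^sup>2"
proof -
  have "0 \<le> (norm ((x' - x) + t *\<^sub>R \<alpha>))\<^sup>2" by simp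
  then have "0 \<le> (norm (x' - x))\<^sup>2 / 2 + t * (\<alpha> \<bullet> (x' - x)) + t\<^sup>2 / 2 * (norm \<alpha>)\<^sup>2"
    unfolding power2_norm_eq_inner
    by (simp add: inner_add_left inner_add_right inner_diff_left inner_diff_right inner_commute
        power2_eq_square field_simps)
  then show ?thesis
    using sparse_psi_strongly_convex[OF lam s, of x'] unfolding bregman_def
    by (simp add: inner_diff_left inner_diff_right algebra_simps)
qed

section \<open>The Fenchel conjugate and the exact projective step\<close>

lemma fenchel_conjugate_eq:
  assumes "s \<in> subdifferential f x"
  shows "fenchel_conjugate f s = s \<bullet> x - f x"
  unfolding fenchel_conjugate_def
proof (rule cSup_eq_maximum)
  fix v assume "v \<in> range (\<lambda>y. s \<bullet> y - f y)"
  then obtain y where "v = s \<bullet> y - f y" by blast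
  then show "v \<le> s \<bullet> x - f x"
    using subdifferentialD[OF assms, of y] by (simp add: inner_diff_right)
qed simp

text \<open>Strong convexity with modulus one dualizes to smoothness of the conjugate, whose
  gradient at \<open>s\<close> is \<open>x\<close>; Young's inequality handles the mixed
  term.\<close>

lemma fenchel_conjugate_sparse_psi_le:
  fixes x s u :: "real^'n"
  assumes lam: "0 \<le> lam" and s: "s \<in> subdifferential (sparse_psi lam) x"
  shows "fenchel_conjugate (sparse_psi lam) u
    \<le> fenchel_conjugate (sparse_psi lam) s + (u - s) \<bullet> x + (norm (u - s))\<^sup>2 / 2"
proof -
  let ?y = "soft_threshold lam u"
  have "q \<bullet> p \<le> (norm p)\<^sup>2 / 2 + (norm q)\<^sup>2 / 2" for p q :: "real^'n"
  proof -
    have "0 \<le> (p - q) \<bullet> (p - q)" by simp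
    then show ?thesis
      by (simp add: power2_norm_eq_inner inner_diff_left inner_diff_right inner_commute)
  qed
  from this[of "u - s" "?y - x"] show ?thesis
    using sparse_psi_strongly_convex[OF lam s, of ?y]
    unfolding fenchel_conjugate_eq[OF s] fenchel_conjugate_eq[OF soft_threshold_subgradient[OF lam, of u]]
    by (simp add: inner_diff_left inner_diff_right algebra_simps)
qed

lemma fenchel_conjugate_sparse_psi_ge:
  fixes x s u :: "real^'n"
  assumes lam: "0 \<le> lam" and s: "s \<in> subdifferential (sparse_psi lam) x"
  shows "fenchel_conjugate (sparse_psi lam) s + (u - s) \<bullet> x \<le> fenchel_conjugate (sparse_psi lam) u"
  using subdifferentialD[OF soft_threshold_subgradient[OF lam], of u x]
  unfolding fenchel_conjugate_eq[OF s] fenchel_conjugate_eq[OF soft_threshold_subgradient[OF lam, of u]]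
  by (simp add: inner_diff_left inner_diff_right algebra_simps)

text \<open>The minimizer \<open>t\<close> is nonnegative because the objective decreases to first order at \<open>0\<close>; its
  value is compared with that of the step \<open>g / \<parallel>\<alpha>\<parallel>\<^sup>2\<close>.\<close>

lemma bregman_exact_step_le:
  fixes x x' z s \<alpha> :: "real^'n"
  assumes lam: "0 \<le> lam" and s: "s \<in> subdifferential (sparse_psi lam) x"
    and s': "s - t *\<^sub>R \<alpha> \<in> subdifferential (sparse_psi lam) x'"
    and t: "is_arg_min (\<lambda>r. fenchel_conjugate (sparse_psi lam) (s - r *\<^sub>R \<alpha>) + r * (\<alpha> \<bullet> x - g)) (\<lambda>_. True) t"
    and g: "0 < g" "g \<le> \<alpha> \<bullet> (x - z)"
  shows "bregman (sparse_psi lam) (s - t *\<^sub>R \<alpha>) x' z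
    \<le> bregman (sparse_psi lam) s x z - g\<^sup>2 / (2 * (norm \<alpha>)\<^sup>2)"
proof -
  let ?F = "fenchel_conjugate (sparse_psi lam)"
  let ?h = "\<lambda>r. ?F (s - r *\<^sub>R \<alpha>) + r * (\<alpha> \<bullet> x - g)"
  have tmin: "?h t \<le> ?h r" for r using t unfolding is_arg_min_def by (meson not_le_imp_less)
  have \<alpha>0: "0 < (norm \<alpha>)\<^sup>2" using g by auto
  have t0: "0 \<le> t"
  proof (rule ccontr)
    assume "\<not> 0 \<le> t"
    then have "0 < - t * g" using g by (simp add: mult_neg_pos)
    moreover have "?F s - t * g \<le> ?h t"
      using fenchel_conjugate_sparse_psi_ge[OF lam s, of "s - t *\<^sub>R \<alpha>"] by (simp add: algebra_simps)
    ultimately show False using tmin[of 0] by simp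
  qed
  define r where "r = g / (norm \<alpha>)\<^sup>2"
  have "?h t \<le> ?h r" by (rule tmin)
  also have "\<dots> \<le> ?F s - r * g + r\<^sup>2 * (norm \<alpha>)\<^sup>2 / 2"
    using fenchel_conjugate_sparse_psi_le[OF lam s, of "s - r *\<^sub>R \<alpha>"]
    by (simp add: power_mult_distrib algebra_simps)
  also have "\<dots> = ?F s - g\<^sup>2 / (2 * (norm \<alpha>)\<^sup>2)"
    using \<alpha>0 by (simp add: r_def power2_eq_square field_simps)
  finally have h: "?h t \<le> ?F s - g\<^sup>2 / (2 * (norm \<alpha>)\<^sup>2)" .
  \<comment> \<open>By the Fenchel equalities the Bregman distance changes by
    \<open>?h t - ?F s + t * g - t * (\<alpha> \<bullet> (x - z))\<close>, so nonnegativity of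
    \<open>t\<close> leaves only the first difference.\<close>
  have "t * g \<le> t * (\<alpha> \<bullet> (x - z))" using t0 g by (intro mult_left_mono)
  then show ?thesis
    using h unfolding bregman_def fenchel_conjugate_eq[OF s] fenchel_conjugate_eq[OF s']
    by (simp add: inner_diff_left inner_diff_right algebra_simps)
qed

text \<open>A_J and its transpose have the same norm: pairing the sum \<open>y\<close> with itself
  gives a common factor (norm y)^2, which cancels.\<close>

lemma frame_bound_norm_sum_le:
  fixes a :: "'m \<Rightarrow> 'a::real_inner"
  assumes fb: "frame_bound a J t" and t: "0 \<le> t"
  shows "(norm (\<Sum>j\<in>J. v j *\<^sub>R a j))\<^sup>2 \<le> t * (\<Sum>j\<in>J. (v j)\<^sup>2)"
proof -
  define y where "y = (\<Sum>j\<in>J. v j *\<^sub>R a j)"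
  have "(norm y)\<^sup>2 = (\<Sum>j\<in>J. v j * (a j \<bullet> y))"
    unfolding power2_norm_eq_inner by (subst y_def) (simp add: inner_sum_left)
  then have "((norm y)\<^sup>2)\<^sup>2 \<le> (\<Sum>j\<in>J. (v j)\<^sup>2) * (\<Sum>j\<in>J. (a j \<bullet> y)\<^sup>2)"
    using Cauchy_Schwarz_ineq_sum by metis
  also have "\<dots> \<le> (\<Sum>j\<in>J. (v j)\<^sup>2) * (t * (norm y)\<^sup>2)"
    using fb by (intro mult_left_mono) (auto simp: frame_bound_def sum_nonneg)
  finally have *: "(norm y)\<^sup>2 * (norm y)\<^sup>2 \<le> t * (\<Sum>j\<in>J. (v j)\<^sup>2) * (norm y)\<^sup>2"
    by (simp add: power2_eq_square mult_ac)
  show ?thesis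
  proof (cases "y = 0")
    case True
    then show ?thesis using t unfolding y_def[symmetric] by (simp add: sum_nonneg)
  next
    case False
    then show ?thesis using mult_right_le_imp_le[OF *] unfolding y_def[symmetric] by simp
  qed
qed

section \<open>Row losses and expected decay\<close>

lemma residual_row:
  "residual I (A *v x - b) $ j =
    (if j \<in> I then row j A \<bullet> x - b $ j else max (row j A \<bullet> x - b $ j) 0)"
  by (simp add: residual_def matrix_vector_component_row)

lemma row_loss_unit_row:
  "norm (row j A) = 1 \<Longrightarrow> row_loss A b I j x = (residual I (A *v x - b) $ j)\<^sup>2 / 2"
  by (simp add: row_loss_def)

lemma has_derivative_imp_gradient:
  assumes "(f has_derivative (\<lambda>h. g \<bullet> h)) (at x)"
  shows "gradient f x = g"
  unfolding gradient_def
proof (rule the_equality)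
  show "GDERIV f x :> g" using assms by (simp add: gderiv_def inner_commute)
  fix g' assume "GDERIV f x :> g'"
  then have "(f has_derivative (\<lambda>h. g' \<bullet> h)) (at x)" by (simp add: gderiv_def inner_commute)
  with assms have "(\<lambda>h. g' \<bullet> h) = (\<lambda>h. g \<bullet> h)" by (metis has_derivative_unique)
  then show "g' = g" by (metis vector_eq_rdot inner_commute)
qed

text \<open>Twice the remainder of the linear approximation is at most h^2 for all signs of
  \<open>u\<close> and \<open>u + h\<close>, which covers the kink at 0.\<close>

lemma DERIV_half_square_positive_part:
  "((\<lambda>u::real. (max u 0)\<^sup>2 / 2) has_field_derivative max u 0) (at u)"
  unfolding DERIV_def
proof -
  have bnd: "\<bar>((max (u + h) 0)\<^sup>2 / 2 - (max u 0)\<^sup>2 / 2) / h - max u 0\<bar> \<le> \<bar>h\<bar> / 2" if "h \<noteq> 0" for h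
  proof -
    have "\<bar>(max (u + h) 0)\<^sup>2 - (max u 0)\<^sup>2 - 2 * h * max u 0\<bar> \<le> h\<^sup>2"
    proof (cases "0 \<le> u"; cases "0 \<le> u + h")
      assume "0 \<le> u" "0 \<le> u + h"
      then show ?thesis by (simp add: power2_eq_square algebra_simps)
    next
      assume a: "0 \<le> u" "\<not> 0 \<le> u + h"
      then have "u * (u + h) \<le> 0" "h * u \<le> 0" by (simp_all add: mult_le_0_iff)
      moreover have "0 \<le> (u + h) * (u + h)" by simp
      moreover have "0 \<le> h * h" by simp
      ultimately show ?thesis using a by (simp add: power2_eq_square abs_le_iff algebra_simps)
    next
      assume a: "\<not> 0 \<le> u" "0 \<le> u + h"
      then have "(u + h)\<^sup>2 \<le> h\<^sup>2" by (intro power_mono) auto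
      then show ?thesis using a by simp
    next
      assume "\<not> 0 \<le> u" "\<not> 0 \<le> u + h"
      then show ?thesis by simp
    qed
    then have "\<bar>((max (u + h) 0)\<^sup>2 - (max u 0)\<^sup>2 - 2 * h * max u 0) / (2 * h)\<bar> \<le> h\<^sup>2 / \<bar>2 * h\<bar>"
      unfolding abs_divide by (rule divide_right_mono) simp
    also have "h\<^sup>2 / \<bar>2 * h\<bar> = \<bar>h\<bar> / 2"
      using that by (simp add: abs_mult power2_eq_square abs_if)
    also have "((max (u + h) 0)\<^sup>2 - (max u 0)\<^sup>2 - 2 * h * max u 0) / (2 * h)
        = ((max (u + h) 0)\<^sup>2 / 2 - (max u 0)\<^sup>2 / 2) / h - max u 0"
      using that by (simp add: field_simps)
    finally show ?thesis .
  qed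
  have "(\<lambda>h. ((max (u + h) 0)\<^sup>2 / 2 - (max u 0)\<^sup>2 / 2) / h - max u 0) \<midarrow>0\<rightarrow> 0"
  proof (rule Lim_null_comparison)
    show "\<forall>\<^sub>F h in at 0. norm (((max (u + h) 0)\<^sup>2 / 2 - (max u 0)\<^sup>2 / 2) / h - max u 0) \<le> \<bar>h\<bar> / 2"
      using bnd by (auto simp: eventually_at_filter)
    show "((\<lambda>h::real. \<bar>h\<bar> / 2) \<longlongrightarrow> 0) (at 0)" by (rule tendsto_eq_intros | simp)+
  qed
  then show "(\<lambda>h. ((max (u + h) 0)\<^sup>2 / 2 - (max u 0)\<^sup>2 / 2) / h) \<midarrow>0\<rightarrow> max u 0"
    by (rule LIM_zero_cancel)
qed

lemma gradient_row_loss: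
  assumes "norm (row j A) = 1"
  shows "gradient (row_loss A b I j) x = (residual I (A *v x - b) $ j) *\<^sub>R row j A"
proof (rule has_derivative_imp_gradient)
  let ?\<phi> = "\<lambda>u::real. if j \<in> I then u\<^sup>2 / 2 else (max u 0)\<^sup>2 / 2"
  let ?g = "\<lambda>x. row j A \<bullet> x - b $ j"
  have f: "row_loss A b I j = (\<lambda>x. ?\<phi> (?g x))"
    by (rule ext) (simp add: row_loss_unit_row[OF assms] residual_row)
  have "(?\<phi> has_field_derivative (residual I (A *v x - b) $ j)) (at (?g x))"
    by (cases "j \<in> I") (auto simp: residual_row intro!: DERIV_half_square_positive_part derivative_eq_intros)
  moreover have "(?g has_derivative (\<lambda>h. row j A \<bullet> h)) (at x)"
    by (auto intro!: derivative_eq_intros)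
  ultimately have "((\<lambda>x. ?\<phi> (?g x)) has_derivative (\<lambda>h. (row j A \<bullet> h) * (residual I (A *v x - b) $ j))) (at x)"
    by (rule DERIV_compose_FDERIV)
  then show "(row_loss A b I j has_derivative (\<lambda>h. (residual I (A *v x - b) $ j) *\<^sub>R row j A \<bullet> h)) (at x)"
    unfolding f by (simp add: mult.commute)
qed

lemma residual_eq_0_iff_feasible:
  "z \<in> feasible_set A b I \<longleftrightarrow> (\<forall>j. residual I (A *v z - b) $ j = 0)"
  by (auto simp: feasible_set_def residual_row matrix_vector_component_row max_def)

text \<open>Feasibility of \<open>z\<close> gives <a_j, x - z> >= <a_j, x> - b_j, with equality on
  equality rows; on inequality rows the residual multiplying it is nonnegative.\<close>

lemma residual_sq_le_inner:
  assumes "z \<in> feasible_set A b I"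
  shows "(residual I (A *v x - b) $ j)\<^sup>2 \<le> (residual I (A *v x - b) $ j) * (row j A \<bullet> (x - z))"
proof (cases "j \<in> I")
  case True
  then have "row j A \<bullet> z = b $ j" using assms by (simp add: feasible_set_def matrix_vector_component_row)
  then show ?thesis using True by (simp add: residual_row inner_diff_right power2_eq_square)
next
  case False
  then have "row j A \<bullet> z \<le> b $ j" using assms by (simp add: feasible_set_def matrix_vector_component_row)
  then show ?thesis using False
    by (auto simp: residual_row inner_diff_right power2_eq_square max_def intro!: mult_left_mono)
qed

lemma avg_loss_nonneg: "0 \<le> avg_loss A b I x"
  by (simp add: avg_loss_def row_loss_def sum_nonneg)

lemma avg_loss_eq_0_iff:
  fixes A :: "real^'n^'m"
  assumes unit: "\<And>i. norm (row i A) = 1"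
  shows "avg_loss A b I x = 0 \<longleftrightarrow> x \<in> feasible_set A b I"
proof -
  have "avg_loss A b I x = 0 \<longleftrightarrow> (\<forall>j. row_loss A b I j x = 0)"
    unfolding avg_loss_def by (simp add: sum_nonneg_eq_0_iff row_loss_def)
  then show ?thesis by (simp add: row_loss_unit_row[OF unit] residual_eq_0_iff_feasible)
qed

lemma argmin_avg_loss:
  fixes A :: "real^'n^'m"
  assumes unit: "\<And>i. norm (row i A) = 1" and ne: "feasible_set A b I \<noteq> {}"
  shows "argmin_set (avg_loss A b I) = feasible_set A b I"
proof -
  obtain z where z: "avg_loss A b I z = 0" using ne avg_loss_eq_0_iff[OF unit] by blast
  have "is_arg_min (avg_loss A b I) (\<lambda>_. True) x \<longleftrightarrow> avg_loss A b I x = 0" for x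
    unfolding is_arg_min_def using avg_loss_nonneg[of A b I] z by (metis antisym_conv2 not_less)
  then show ?thesis by (auto simp: argmin_set_def avg_loss_eq_0_iff[OF unit])
qed

lemma INF_avg_loss:
  fixes A :: "real^'n^'m"
  assumes unit: "\<And>i. norm (row i A) = 1" and ne: "feasible_set A b I \<noteq> {}"
  shows "(INF y. avg_loss A b I y) = 0"
proof -
  obtain z where z: "avg_loss A b I z = 0" using ne avg_loss_eq_0_iff[OF unit] by blast
  show ?thesis
    by (rule cInf_eq_minimum) (use avg_loss_nonneg z in \<open>auto simp: image_iff intro: exI[of _ z]\<close>)
qed

lemma bregman_dist_sq_nonneg:
  "s \<in> subdifferential f x \<Longrightarrow> X \<noteq> {} \<Longrightarrow> 0 \<le> bregman_dist_sq f s x X"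
  unfolding bregman_dist_sq_def by (intro cINF_greatest) (auto intro: bregman_nonneg)

text \<open>The decrease \<open>d\<close> is the same for all \<open>z\<close>, so it passes to the
  infimum without a nearest point being chosen.\<close>

lemma bregman_dist_sq_decrease:
  assumes s': "s' \<in> subdifferential f x'" and X: "X \<noteq> {}"
    and le: "\<And>z. z \<in> X \<Longrightarrow> bregman f s' x' z \<le> bregman f s x z - d"
  shows "bregman_dist_sq f s' x' X \<le> bregman_dist_sq f s x X - d"
proof -
  have bdd: "bdd_below (bregman f s' x' ` X)"
    by (rule bdd_belowI[of _ 0]) (auto intro: bregman_nonneg[OF s'])
  have "bregman_dist_sq f s' x' X + d \<le> bregman f s x z" if "z \<in> X" for z
    using cINF_lower[OF bdd that] le[OF that] unfolding bregman_dist_sq_def by linarith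
  then have "bregman_dist_sq f s' x' X + d \<le> bregman_dist_sq f s x X"
    unfolding bregman_dist_sq_def[of f s x] by (intro cINF_greatest X)
  then show ?thesis by simp
qed

text \<open>Conditioning on all but the last sample. The factor \<open>q\<close> may be negative, so
  the final induction has two cases.\<close>

lemma expectation_replicate_pmf_decay:
  fixes D :: "'b list \<Rightarrow> real"
  assumes S: "finite S" "S \<noteq> {}"
    and nn: "\<And>h. h \<in> lists S \<Longrightarrow> 0 \<le> D h"
    and step: "\<And>h. h \<in> lists S \<Longrightarrow> (\<Sum>i\<in>S. D (h @ [i])) / real (card S) \<le> q * D h"
  shows "measure_pmf.expectation (replicate_pmf k (pmf_of_set S)) D \<le> q ^ k * D []"
proof -
  let ?p = "pmf_of_set S"
  let ?E = "\<lambda>k. measure_pmf.expectation (replicate_pmf k ?p) D"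
  let ?L = "\<lambda>k. {h \<in> lists S. length h = k}"
  have supp: "set_pmf (replicate_pmf k ?p) = ?L k" for k
    by (simp add: set_replicate_pmf set_pmf_of_set S)
  have fin: "finite (?L k)" for k
    using finite_lists_length_eq[OF S(1), of k] by (simp add: lists_eq_set)
  have E: "?E k = (\<Sum>h\<in>?L k. pmf (replicate_pmf k ?p) h * D h)" for k
    by (subst integral_measure_pmf[OF fin[of k]]) (auto simp: supp)
  have E0: "0 \<le> ?E k" for k
    unfolding E by (intro sum_nonneg mult_nonneg_nonneg) (auto intro: nn)
  have ES: "?E (Suc k) \<le> q * ?E k" for k
  proof -
    \<comment> \<open>\<open>replicate_pmf\<close> prepends its samples, whereas histories grow at
      the end.\<close>
    have "replicate_pmf (Suc k) ?p = replicate_pmf k ?p \<bind> (\<lambda>h. map_pmf (\<lambda>i. h @ [i]) ?p)"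
      using replicate_pmf_distrib[of k 1 ?p]
      by (simp add: map_pmf_def bind_return_pmf bind_assoc_pmf)
    then have "?E (Suc k) =
        (\<Sum>h\<in>?L k. pmf (replicate_pmf k ?p) h *\<^sub>R measure_pmf.expectation (map_pmf (\<lambda>i. h @ [i]) ?p) D)"
      using S by (simp only:) (rule pmf_expectation_bind, auto simp: fin supp)
    also have "\<dots> = (\<Sum>h\<in>?L k. pmf (replicate_pmf k ?p) h * ((\<Sum>i\<in>S. D (h @ [i])) / real (card S)))"
      using S by (simp add: integral_pmf_of_set)
    also have "\<dots> \<le> (\<Sum>h\<in>?L k. pmf (replicate_pmf k ?p) h * (q * D h))"
      by (intro sum_mono mult_left_mono step) auto
    also have "\<dots> = q * ?E k" unfolding E by (simp add: sum_distrib_left mult_ac)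
    finally show ?thesis .
  qed
  have Z: "?E 0 = D []" by simp
  show ?thesis
  proof (cases "0 \<le> q")
    case True
    show ?thesis
    proof (induction k)
      case (Suc k)
      have "?E (Suc k) \<le> q * ?E k" by (rule ES)
      also have "\<dots> \<le> q * (q ^ k * D [])" using Suc True by (rule mult_left_mono)
      finally show ?case by (simp add: mult_ac)
    qed simp
  next
    case False
    \<comment> \<open>With \<open>q < 0\<close>, the one-step bound and nonnegativity of
      \<open>D\<close> leave no value but 0.\<close>
    have z: "?E k = 0" for k
    proof -
      have "0 \<le> q * ?E k" using ES[of k] E0[of "Suc k"] by linarith
      then have "?E k \<le> 0" using False by (simp add: zero_le_mult_iff)
      then show ?thesis using E0[of k] by linarith
    qed
    show ?thesis using z[of k] z[of 0] Z by simp
  qed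
qed

lemma sum_blocks:
  fixes g :: "'m::finite \<Rightarrow> real"
  assumes \<kappa>: "\<kappa> \<in> row_orderings" and lt: "l * \<tau> = CARD('m)"
  shows "(\<Sum>i\<in>{1..l}. \<Sum>j\<in>block \<kappa> \<tau> i. g j) = (\<Sum>j\<in>UNIV. g j)"
proof -
  have bij: "bij_betw \<kappa> {1..CARD('m)} UNIV" using \<kappa> by (simp add: row_orderings_def)
  have "(\<Sum>j\<in>block \<kappa> \<tau> (Suc i). g j) = (\<Sum>r\<in>{i * \<tau>..<i * \<tau> + \<tau>}. g (\<kappa> (Suc r)))" if "i < l" for i
  proof -
    have "Suc i * \<tau> \<le> l * \<tau>" using that by (intro mult_le_mono1) simp
    then have "{(Suc i - 1) * \<tau> + 1..Suc i * \<tau>} \<subseteq> {1..CARD('m)}" using lt by auto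
    then have "inj_on \<kappa> {(Suc i - 1) * \<tau> + 1..Suc i * \<tau>}"
      using bij by (auto simp: bij_betw_def intro: inj_on_subset)
    then have "(\<Sum>j\<in>block \<kappa> \<tau> (Suc i). g j) = (\<Sum>r\<in>{(Suc i - 1) * \<tau> + 1..Suc i * \<tau>}. g (\<kappa> r))"
      unfolding block_def by (simp add: sum.reindex)
    \<comment> \<open>Blocks and positions count from 1; both are shifted to 0 so that consecutive
      intervals can be joined.\<close>
    also have "{(Suc i - 1) * \<tau> + 1..Suc i * \<tau>} = {Suc (i * \<tau>)..<Suc (i * \<tau> + \<tau>)}" by auto
    finally show ?thesis by (simp only: sum.shift_bounds_Suc_ivl)
  qed
  then have "(\<Sum>i<l. \<Sum>j\<in>block \<kappa> \<tau> (Suc i). g j) = (\<Sum>i<l. \<Sum>r\<in>{i * \<tau>..<i * \<tau> + \<tau>}. g (\<kappa> (Suc r)))"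
    by (intro sum.cong refl) auto
  also have "\<dots> = (\<Sum>r<l * \<tau>. g (\<kappa> (Suc r)))" by (rule sum.nat_group)
  also have "\<dots> = (\<Sum>r\<in>{1..CARD('m)}. g (\<kappa> r))"
    unfolding lt by (rule sum.reindex_bij_witness[of _ "\<lambda>r. r - 1" Suc]) auto
  also have "\<dots> = (\<Sum>j\<in>UNIV. g j)" by (rule sum.reindex_bij_betw[OF bij])
  also have "(\<Sum>i<l. \<Sum>j\<in>block \<kappa> \<tau> (Suc i). g j) = (\<Sum>i\<in>{1..l}. \<Sum>j\<in>block \<kappa> \<tau> i. g j)"
    by (rule sum.reindex_bij_witness[of _ "\<lambda>r. r - 1" Suc]) auto
  finally show ?thesis .
qed

section \<open>Convergence rates\<close>

text \<open>One fixed ordering with good blocks, so that only the sampling is random.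
  \<open>bound\<close> stays abstract: the DecmSPS rate is stated with any larger \<open>M\<close>,
  the projective rate with \<open>bound\<close> itself.\<close>

locale block_kaczmarz =
  fixes A :: "real^'n^'m" and b :: "real^'m" and I :: "'m set"
    and lam gam bound :: real and \<tau> l :: nat and \<kappa> :: "nat \<Rightarrow> 'm"
    and x0 xs0 :: "real^'n" and t :: "nat list \<Rightarrow> real" and x xs :: "nat list \<Rightarrow> real^'n"
  assumes unit: "\<And>i. norm (row i A) = 1"
    and feasible: "feasible_set A b I \<noteq> {}"
    and lam: "0 < lam"
    and growth: "bregman_growth lam A b I gam"
    and \<kappa>: "\<kappa> \<in> row_orderings" and l: "0 < l" and lt: "l * \<tau> = CARD('m)"
    and bound: "0 < bound"
    and blocks: "\<And>i. i \<in> {1..l} \<Longrightarrow> frame_bound (\<lambda>j. row j A) (block \<kappa> \<tau> i) bound"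
    and start: "xs0 \<in> subdifferential (sparse_psi lam) x0"
    and scheme: "kaczmarz_scheme lam A b I \<tau> l \<kappa> x0 xs0 t x xs"
begin

abbreviation "res y j \<equiv> residual I (A *v y - b) $ j"
abbreviation "loss h i \<equiv> block_loss A b I \<tau> (block \<kappa> \<tau> i) (x h)"
abbreviation "grad h i \<equiv> block_grad A b I \<tau> (block \<kappa> \<tau> i) (x h)"
abbreviation "dist_sq h \<equiv> bregman_dist_sq (sparse_psi lam) (xs h) (x h) (argmin_set (avg_loss A b I))"
abbreviation "stationary h i \<equiv> \<forall>j\<in>block \<kappa> \<tau> i. gradient (row_loss A b I j) (x h) = 0"

lemma \<tau>_pos: "0 < \<tau>"
  using lt by (metis gr0I mult_is_0 zero_less_card_finite less_numeral_extra(3))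

lemma block_loss_residual: "block_loss A b I \<tau> J y = (\<Sum>j\<in>J. (res y j)\<^sup>2) / (2 * real \<tau>)"
  by (simp add: block_loss_def row_loss_unit_row[OF unit] sum_divide_distrib mult.commute)

lemma block_grad_residual: "block_grad A b I \<tau> J y = (\<Sum>j\<in>J. (res y j / real \<tau>) *\<^sub>R row j A)"
  by (simp add: block_grad_def gradient_row_loss[OF unit])

lemma block_grad_sq_eq: "block_grad_sq A b I \<tau> J y = 2 * block_loss A b I \<tau> J y"
  by (simp add: block_grad_sq_def block_loss_residual gradient_row_loss[OF unit] unit
      sum_divide_distrib[symmetric])

lemma loss_nonneg: "0 \<le> loss h i"
  by (simp add: block_loss_residual sum_nonneg)

lemma gradient_eq_0_iff: "gradient (row_loss A b I j) y = 0 \<longleftrightarrow> res y j = 0"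
  using unit[of j] by (auto simp: gradient_row_loss[OF unit])

lemma stationary_iff: "stationary h i \<longleftrightarrow> loss h i = 0"
  unfolding gradient_eq_0_iff block_loss_residual using \<tau>_pos by (simp add: sum_nonneg_eq_0_iff)

lemma grad_stationary: "stationary h i \<Longrightarrow> grad h i = 0"
  by (simp add: gradient_eq_0_iff block_grad_residual)

lemma inner_grad_ge:
  assumes "z \<in> feasible_set A b I"
  shows "2 * loss h i \<le> grad h i \<bullet> (x h - z)"
proof -
  have "2 * loss h i = (\<Sum>j\<in>block \<kappa> \<tau> i. (res (x h) j)\<^sup>2 / real \<tau>)"
    by (simp add: block_loss_residual sum_divide_distrib[symmetric])
  also have "\<dots> \<le> (\<Sum>j\<in>block \<kappa> \<tau> i. (res (x h) j) * (row j A \<bullet> (x h - z)) / real \<tau>)"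
    by (intro sum_mono divide_right_mono residual_sq_le_inner assms) simp
  also have "\<dots> = grad h i \<bullet> (x h - z)" by (simp add: block_grad_residual inner_sum_left)
  finally show ?thesis .
qed

text \<open>The row gradients cannot cancel: against the direction to a feasible point their
  weighted sum has inner product at least twice the positive loss. Hence the stepsize quotients are
  well defined.\<close>

lemma grad_nonzero: "\<not> stationary h i \<Longrightarrow> 0 < (norm (grad h i))\<^sup>2"
proof -
  assume "\<not> stationary h i"
  then have "0 < loss h i" using stationary_iff loss_nonneg[where h = h and i = i] by (metis less_le)
  moreover obtain z where "z \<in> feasible_set A b I" using feasible by blast
  ultimately have "grad h i \<noteq> 0" using inner_grad_ge[of z, where h = h and i = i] by auto
  then show ?thesis by simp
qed

text \<open>The spectral bound of the blocks enters here. The squared weights 1/\<tau>^2 against the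
  single 1/\<tau> in the loss produce the gain in \<tau>.\<close>

lemma norm_grad_le:
  assumes "i \<in> {1..l}"
  shows "(norm (grad h i))\<^sup>2 \<le> 2 * bound / real \<tau> * loss h i"
proof -
  have "(norm (grad h i))\<^sup>2 \<le> bound * (\<Sum>j\<in>block \<kappa> \<tau> i. (res (x h) j / real \<tau>)\<^sup>2)"
    unfolding block_grad_residual using frame_bound_norm_sum_le[OF blocks[OF assms]] bound by simp
  also have "\<dots> = 2 * bound / real \<tau> * loss h i"
    using \<tau>_pos by (simp add: block_loss_residual power_divide sum_divide_distrib[symmetric] power2_eq_square)
  finally show ?thesis .
qed

lemma start_eq: "x [] = x0" "xs [] = xs0"
  using scheme by (auto simp: kaczmarz_scheme_def)

lemma dual_step:
  assumes "h \<in> lists {1..l}" "i \<in> {1..l}"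
  shows "xs (h @ [i]) = xs h - t (h @ [i]) *\<^sub>R grad h i"
  using scheme assms by (simp add: kaczmarz_scheme_def block_grad_residual unit)

lemma dual_in_subdifferential:
  assumes "h \<in> lists {1..l}"
  shows "xs h \<in> subdifferential (sparse_psi lam) (x h)"
proof (cases h rule: rev_cases)
  case Nil
  then show ?thesis using start by (simp add: start_eq)
next
  case (snoc g i)
  then have "x h = soft_threshold lam (xs h)"
    using scheme assms by (auto simp: kaczmarz_scheme_def)
  then show ?thesis using soft_threshold_subgradient[of lam "xs h"] lam by simp
qed

lemma bregman_step:
  assumes "h \<in> lists {1..l}" "i \<in> {1..l}"
  shows "bregman (sparse_psi lam) (xs (h @ [i])) (x (h @ [i])) z \<le> bregman (sparse_psi lam) (xs h) (x h) z
    - t (h @ [i]) * (grad h i \<bullet> (x h - z)) + (t (h @ [i]))\<^sup>2 / 2 * (norm (grad h i))\<^sup>2"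
  unfolding dual_step[OF assms]
  using lam by (intro bregman_step_le dual_in_subdifferential assms) simp

lemma avg_block_loss: "(\<Sum>i\<in>{1..l}. loss h i) / real l = avg_loss A b I (x h)"
proof -
  have "(\<Sum>i\<in>{1..l}. loss h i) = (\<Sum>j\<in>UNIV. 1 / real \<tau> * row_loss A b I j (x h))"
    unfolding block_loss_def by (rule sum_blocks[OF \<kappa> lt])
  then show ?thesis
    by (simp add: avg_loss_def sum_distrib_left sum_divide_distrib flip: lt) (simp add: mult.commute)
qed

text \<open>A stepsize rule has to supply only \<open>r\<close>. The average of the block losses is
  F, whose minimum is 0, and the growth condition bounds F from below by the distance.\<close>

lemma expected_dist_sq_decay:
  assumes r: "0 \<le> r"
    and dec: "\<And>h i z. h \<in> lists {1..l} \<Longrightarrow> i \<in> {1..l} \<Longrightarrow> z \<in> feasible_set A b I \<Longrightarrow>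
      bregman (sparse_psi lam) (xs (h @ [i])) (x (h @ [i])) z
        \<le> bregman (sparse_psi lam) (xs h) (x h) z - r * loss h i"
  shows "expected_dist_sq lam A b I l x xs k \<le>
    (1 - r * gam) ^ k * bregman_dist_sq (sparse_psi lam) xs0 x0 (argmin_set (avg_loss A b I))"
proof -
  note am = argmin_avg_loss[OF unit feasible]
  have ne: "argmin_set (avg_loss A b I) \<noteq> {}" using am feasible by simp
  have step: "(\<Sum>i\<in>{1..l}. dist_sq (h @ [i])) / real (card {1..l}) \<le> (1 - r * gam) * dist_sq h"
    if h: "h \<in> lists {1..l}" for h
  proof -
    have "dist_sq (h @ [i]) \<le> dist_sq h - r * loss h i" if i: "i \<in> {1..l}" for i
    proof (rule bregman_dist_sq_decrease)
      show "xs (h @ [i]) \<in> subdifferential (sparse_psi lam) (x (h @ [i]))"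
        by (rule dual_in_subdifferential) (use h i in auto)
    qed (use ne dec[OF h i] am in auto)
    then have "(\<Sum>i\<in>{1..l}. dist_sq (h @ [i])) \<le> (\<Sum>i\<in>{1..l}. dist_sq h - r * loss h i)"
      by (rule sum_mono)
    also have "\<dots> = real l * dist_sq h - r * (\<Sum>i\<in>{1..l}. loss h i)"
      by (simp add: sum_subtractf sum_distrib_left)
    finally have "(\<Sum>i\<in>{1..l}. dist_sq (h @ [i])) / real l
        \<le> (real l * dist_sq h - r * (\<Sum>i\<in>{1..l}. loss h i)) / real l"
      by (rule divide_right_mono) simp
    also have "\<dots> = dist_sq h - r * avg_loss A b I (x h)"
      unfolding avg_block_loss[symmetric] using l by (simp add: diff_divide_distrib)
    also have "\<dots> \<le> dist_sq h - r * (gam * dist_sq h)"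
      using growth dual_in_subdifferential[OF h] r INF_avg_loss[OF unit feasible]
      by (intro diff_left_mono mult_left_mono) (auto simp: bregman_growth_def)
    finally show ?thesis by (simp add: algebra_simps)
  qed
  have "measure_pmf.expectation (replicate_pmf k (pmf_of_set {1..l})) dist_sq \<le> (1 - r * gam) ^ k * dist_sq []"
    using l by (intro expectation_replicate_pmf_decay bregman_dist_sq_nonneg dual_in_subdifferential ne step) auto
  then show ?thesis by (simp add: expected_dist_sq_def start_eq)
qed

text \<open>The first entry of the minimum gives t ||\<alpha>||^2 <= loss / c, so the quadratic term
  of the step costs at most t loss / (2 c). The spectral bound keeps that entry at least \<tau> / (2
  M c), so no stepsize falls below \<open>T\<close>.\<close>

lemma decmsps_rate:
  assumes c: "1 / 2 < c" and gam_b: "0 < gam_b" and M: "bound \<le> M"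
    and steps: "decmsps_stepsize A b I \<tau> l \<kappa> c gam_b t x"
  shows "expected_dist_sq lam A b I l x xs k \<le>
    (1 - 1 / c * (1 - 1 / (2 * c)) * gam * min (real \<tau> / (2 * M)) (c * gam_b)) ^ k *
      bregman_dist_sq (sparse_psi lam) xs0 x0 (argmin_set (avg_loss A b I))"
proof -
  define T where "T = min (real \<tau> / (2 * M)) (c * gam_b) / c"
  let ?q = "1 - 1 / (2 * c)"
  have M0: "0 < M" using bound M by linarith
  have c0: "0 < c" "0 \<le> ?q" using c by (auto simp: field_simps)
  have T0: "0 < T" unfolding T_def using c0 gam_b M0 \<tau>_pos by simp
  have st: "t (h @ [i]) = (if stationary h i then t h
      else min (1 / c * (loss h i / (norm (grad h i))\<^sup>2)) (t h))"
    if "h \<in> lists {1..l}" "i \<in> {1..l}" for h i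
    using steps that by (simp add: decmsps_stepsize_def Let_def)
  have ratio: "real \<tau> / (2 * M) \<le> loss h i / (norm (grad h i))\<^sup>2"
    if "i \<in> {1..l}" "\<not> stationary h i" for h i
  proof -
    have "(norm (grad h i))\<^sup>2 \<le> 2 * M / real \<tau> * loss h i"
      using norm_grad_le[OF that(1), where h = h] M loss_nonneg[where h = h and i = i]
      by (smt (verit) divide_right_mono mult_right_mono of_nat_0_le_iff)
    then show ?thesis using grad_nonzero[OF that(2)] M0 \<tau>_pos by (simp add: field_simps)
  qed
  have low: "T \<le> t h" if "h \<in> lists {1..l}" for h
    using that
  proof (induction h rule: rev_induct)
    case Nil
    have "T \<le> c * gam_b / c" unfolding T_def using c0 by (intro divide_right_mono) auto
    then show ?case using steps c0 by (simp add: decmsps_stepsize_def)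
  next
    case (snoc i h)
    then have h: "h \<in> lists {1..l}" "i \<in> {1..l}" and th: "T \<le> t h" by auto
    have "T \<le> 1 / c * (loss h i / (norm (grad h i))\<^sup>2)" if "\<not> stationary h i"
    proof -
      have "T \<le> (loss h i / (norm (grad h i))\<^sup>2) / c"
        unfolding T_def using ratio[OF h(2) that] c0 by (intro divide_right_mono) auto
      then show ?thesis by (simp add: mult.commute)
    qed
    then show ?case using th by (auto simp: st[OF h])
  qed
  have "bregman (sparse_psi lam) (xs (h @ [i])) (x (h @ [i])) z
      \<le> bregman (sparse_psi lam) (xs h) (x h) z - (T * ?q) * loss h i"
    if h: "h \<in> lists {1..l}" and i: "i \<in> {1..l}" and z: "z \<in> feasible_set A b I" for h i z
  proof (cases "stationary h i")
    case True
    have "loss h i = 0" "grad h i = 0" using True stationary_iff grad_stationary by blast+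
    then show ?thesis using bregman_step[OF h i, of z] by simp
  next
    case False
    let ?t = "t (h @ [i])" and ?f = "loss h i" and ?n = "(norm (grad h i))\<^sup>2"
    have n: "0 < ?n" by (rule grad_nonzero[OF False])
    have tT: "T \<le> ?t" by (rule low) (use h i in auto)
    then have t0: "0 \<le> ?t" using T0 by linarith
    have "?t \<le> 1 / c * (?f / ?n)" unfolding st[OF h i] if_not_P[OF False] by (rule min.cobounded1)
    then have "?t * ?n \<le> ?f / c" using n c0 by (simp add: field_simps)
    then have "?t / 2 * (?t * ?n) \<le> ?t / 2 * (?f / c)" using t0 by (intro mult_left_mono) auto
    then have 1: "?t\<^sup>2 / 2 * ?n \<le> ?t * ?f * (1 / (2 * c))" by (simp add: power2_eq_square mult_ac)
    have 2: "?t * (2 * ?f) \<le> ?t * (grad h i \<bullet> (x h - z))"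
      using t0 by (intro mult_left_mono inner_grad_ge[OF z])
    have "T * (?q * ?f) \<le> ?t * (?q * ?f)"
      using tT c0 loss_nonneg[where h = h and i = i] by (intro mult_right_mono) auto
    \<comment> \<open>The linear term contributes 2 t loss, of which the stated rate uses one half;
      this drops the surplus.\<close>
    moreover have "0 \<le> ?t * ?f" using t0 loss_nonneg[where h = h and i = i] by simp
    ultimately show ?thesis using bregman_step[OF h i, of z] 1 2 by (simp add: algebra_simps)
  qed
  moreover have "0 \<le> T * ?q" using T0 c0 by simp
  ultimately have "expected_dist_sq lam A b I l x xs k \<le>
      (1 - (T * ?q) * gam) ^ k * bregman_dist_sq (sparse_psi lam) xs0 x0 (argmin_set (avg_loss A b I))"
    by (intro expected_dist_sq_decay)
  also have "(T * ?q) * gam = 1 / c * ?q * gam * min (real \<tau> / (2 * M)) (c * gam_b)"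
    by (simp add: T_def)
  finally show ?thesis .
qed

text \<open>With g = 2 loss, both rules decrease the distance by at least g^2 / (2 ||\<alpha>||^2),
  and the gradient bound makes this linear in the loss.\<close>

lemma projective_rate:
  assumes steps: "exact_projective_stepsize lam A b I \<tau> l \<kappa> t x xs \<or>
    adaptive_extrapolated_stepsize A b I \<tau> l \<kappa> t x"
  shows "expected_dist_sq lam A b I l x xs k \<le>
    (1 - real \<tau> / bound * gam) ^ k *
      bregman_dist_sq (sparse_psi lam) xs0 x0 (argmin_set (avg_loss A b I))"
proof (rule expected_dist_sq_decay)
  show "0 \<le> real \<tau> / bound" using bound by simp
  fix h i z
  assume h: "h \<in> lists {1..l}" and i: "i \<in> {1..l}" and z: "z \<in> feasible_set A b I"
  let ?t = "t (h @ [i])" and ?f = "loss h i" and ?n = "(norm (grad h i))\<^sup>2"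
  let ?B = "bregman (sparse_psi lam) (xs h) (x h) z"
  let ?B' = "bregman (sparse_psi lam) (xs (h @ [i])) (x (h @ [i])) z"
  show "?B' \<le> ?B - real \<tau> / bound * ?f"
  proof (cases "stationary h i")
    case True
    have "?f = 0" "grad h i = 0" using True stationary_iff grad_stationary by blast+
    then show ?thesis using bregman_step[OF h i, of z] by simp
  next
    case False
    have n: "0 < ?n" by (rule grad_nonzero[OF False])
    have f: "0 < ?f" using False stationary_iff loss_nonneg[where h = h and i = i] by (metis less_le)
    note g = inner_grad_ge[OF z, where h = h and i = i]
    have "?B' \<le> ?B - (2 * ?f)\<^sup>2 / (2 * ?n)"
      using steps
    proof
      assume "exact_projective_stepsize lam A b I \<tau> l \<kappa> t x xs"
      then have "is_arg_min (\<lambda>r. fenchel_conjugate (sparse_psi lam) (xs h - r *\<^sub>R grad h i)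
          + r * (grad h i \<bullet> x h - 2 * ?f)) (\<lambda>_. True) ?t"
        using h i by (simp add: exact_projective_stepsize_def Let_def block_grad_sq_eq)
      moreover have "xs h - ?t *\<^sub>R grad h i \<in> subdifferential (sparse_psi lam) (x (h @ [i]))"
        unfolding dual_step[OF h i, symmetric] by (rule dual_in_subdifferential) (use h i in auto)
      ultimately show ?thesis
        unfolding dual_step[OF h i]
        using lam f g by (intro bregman_exact_step_le dual_in_subdifferential[OF h]) auto
    next
      assume "adaptive_extrapolated_stepsize A b I \<tau> l \<kappa> t x"
      then have t: "?t = 2 * ?f / ?n"
        using h i False by (simp add: adaptive_extrapolated_stepsize_def Let_def block_grad_sq_eq)
      then have "?t * (2 * ?f) \<le> ?t * (grad h i \<bullet> (x h - z))"
        using f n g by (intro mult_left_mono) auto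
      \<comment> \<open>The adaptive stepsize is the minimizer of this quadratic upper
        bound.\<close>
      then have "?B' \<le> ?B - ?t * (2 * ?f) + ?t\<^sup>2 / 2 * ?n"
        using bregman_step[OF h i, of z] by linarith
      also have "\<dots> = ?B - (2 * ?f)\<^sup>2 / (2 * ?n)"
        unfolding t using n by (simp add: power2_eq_square field_simps)
      finally show ?thesis .
    qed
    moreover have "real \<tau> / bound * ?f \<le> (2 * ?f)\<^sup>2 / (2 * ?n)"
    proof -
      have "real \<tau> * ?n \<le> 2 * bound * ?f"
        using norm_grad_le[OF i, where h = h] \<tau>_pos by (simp add: field_simps)
      then have "real \<tau> * ?n * ?f \<le> 2 * bound * ?f * ?f" using f by (intro mult_right_mono) auto
      then show ?thesis using n bound by (simp add: field_simps power2_eq_square)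
    qed
    ultimately show ?thesis by linarith
  qed
qed

end

theorem corollary3:
  fixes A :: "real^'n^'m" and b :: "real^'m" and I :: "'m set"
    and lam gam :: real and \<tau> l :: nat
  assumes "\<And>i. norm (row i A) = 1"
    and "feasible_set A b I \<noteq> {}"
    and "lam > 0"
    and "\<tau> = nat \<lfloor>real CARD('m) / (sigma_max A)\<^sup>2\<rfloor>"
    and "l > 0" and "real l = real CARD('m) / real \<tau>"
    and "gam > 0" and "bregman_growth lam A b I gam"
  shows "measure_pmf.prob (pmf_of_set (row_orderings :: (nat \<Rightarrow> 'm) set))
    {\<kappa>.
      (\<forall>c gam_b x0 xs0 t x xs.
         c > 1 / 2 \<longrightarrow> gam_b > 0 \<longrightarrow> xs0 \<in> subdifferential (sparse_psi lam) x0 \<longrightarrow>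
         kaczmarz_scheme lam A b I \<tau> l \<kappa> x0 xs0 t x xs \<longrightarrow>
         decmsps_stepsize A b I \<tau> l \<kappa> c gam_b t x \<longrightarrow>
         (\<forall>k. expected_dist_sq lam A b I l x xs k \<le>
            (1 - 1 / c * (1 - 1 / (2 * c)) * gam *
               min (real \<tau> / (12 * ln (1 + real CARD('m)))) (c * gam_b)) ^ k *
            bregman_dist_sq (sparse_psi lam) xs0 x0 (argmin_set (avg_loss A b I)))) \<and>
      (\<forall>x0 xs0 t x xs.
         xs0 \<in> subdifferential (sparse_psi lam) x0 \<longrightarrow>
         kaczmarz_scheme lam A b I \<tau> l \<kappa> x0 xs0 t x xs \<longrightarrow>
         exact_projective_stepsize lam A b I \<tau> l \<kappa> t x xs \<or>
           adaptive_extrapolated_stepsize A b I \<tau> l \<kappa> t x \<longrightarrow>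
         (\<forall>k. expected_dist_sq lam A b I l x xs k \<le>
            (1 - real CARD('m) * gam / (6 * (sigma_max A)\<^sup>2 * ln (1 + real CARD('m)))) ^ k *
            bregman_dist_sq (sparse_psi lam) xs0 x0 (argmin_set (avg_loss A b I))))}
    \<ge> 1 - 1 / real CARD('m)"
proof -
  let ?m = "CARD('m)" and ?s = "(sigma_max A)\<^sup>2"
  let ?bound = "6 * ln (1 + real ?m) * (real \<tau> * ?s / real ?m)"
  have s1: "1 \<le> ?s" by (rule sigma_max_ge_1[OF assms(1)])
  \<comment> \<open>Division by zero gives 0, so \<tau> = 0 would contradict
    \<open>l > 0\<close>.\<close>
  have \<tau>0: "0 < \<tau>" using assms(5,6) by (cases "\<tau> = 0") auto
  then have "real (l * \<tau>) = real ?m" using assms(6) by (simp add: field_simps)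
  then have lt: "l * \<tau> = ?m" by (simp only: of_nat_eq_iff)
  have m0: "0 < real ?m" by simp
  have ln0: "0 < ln (1 + real ?m)" by (rule ln_gt_zero) simp
  have s0: "0 < ?s" using s1 by linarith
  have b0: "0 < ?bound"
    by (intro mult_pos_pos divide_pos_pos ln0 s0 m0) (use \<tau>0 in simp_all)
  have "real \<tau> \<le> real ?m / ?s" using assms(4) s1 by (simp add: of_nat_nat)
  then have "real \<tau> * ?s / real ?m \<le> 1" using s0 m0 by (simp add: pos_le_divide_eq)
  then have bM: "?bound \<le> 6 * ln (1 + real ?m)"
    using ln0 by (intro mult_left_le) auto
  \<comment> \<open>The factor \<tau> in \<open>?bound\<close> cancels, so the rate contains the
    unrounded quotient of m by the squared singular value.\<close>
  have rate: "real \<tau> / ?bound * gam = real ?m * gam / (6 * ?s * ln (1 + real ?m))"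
    using \<tau>0 m0 s1 ln0 by (simp add: field_simps)
  have dec: "2 * (6 * ln (1 + real ?m)) = 12 * ln (1 + real ?m)" by simp
  have good: "block_kaczmarz A b I lam gam ?bound \<tau> l \<kappa> x0 xs0 t x xs"
    if "\<kappa> \<in> row_orderings" "\<forall>i\<in>{1..l}. frame_bound (\<lambda>j. row j A) (block \<kappa> \<tau> i) ?bound"
      "xs0 \<in> subdifferential (sparse_psi lam) x0" "kaczmarz_scheme lam A b I \<tau> l \<kappa> x0 xs0 t x xs"
    for \<kappa> x0 xs0 t x xs
    by (rule block_kaczmarz.intro) (use that assms lt b0 in blast)+
  \<comment> \<open>The event of the spectral bound is contained in the event of the
    theorem.\<close>
  show ?thesis
    by (rule order_trans[OF prob_blocks_frame_bound[OF assms(1) frame_bound_sigma_max s1 assms(4,5) lt]],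
        rule measure_pmf.finite_measure_mono)
      (use block_kaczmarz.decmsps_rate[OF good _ _ bM, unfolded dec]
        block_kaczmarz.projective_rate[OF good, unfolded rate] in auto)
qed

end
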